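(* Let $\theta\geq 0$, $a\geq 0$, $b\geq 0$ with $ab<1$, and put $c=b(1-ab)^{-1}$. Then for every $\varphi\in\mathcal{L}^+_a$ and $f\in\mathcal{L}^+_b$ the function $\varphi(\Delta_\theta)f$ belongs to $\mathcal{L}^+_c$, and the map $(\varphi,f)\mapsto\varphi(\Delta_\theta)f$ is continuous from $\mathcal{L}^+_a\times\mathcal{L}^+_b$ (with the topology induced from $\mathcal{A}_a\times\mathcal{A}_b$) into $\mathcal{L}^+_c$ (with the topology induced from $\mathcal{A}_c$).
   Context: Let $\mathcal{E}$ be the set of entire functions. For $b>0$, $\|f\|_b=\sup_{k\in\mathbb{N}_0}b^{-k}|f^{(k)}(0)|$; for $a\geq0$, $\mathcal{A}_a=\{f\in\mathcal{E}:\|f\|_b<\infty\ \forall b>a\}$ with the locally convex topology generated by $\{\|\cdot\|_b: b>a\}$. $\mathcal{L}^+$ is the set of entire functions $f(z)=Cz^l e^{\alpha z}\prod_{j\ge1}(1+\beta_j z)$ with $C\in\mathbb{C}$, $l\in\mathbb{N}_0$, $\alpha\ge0$, $\beta_j\ge\beta_{j+1}\ge0$, $\sum_j\beta_j<\infty$; $\mathcal{L}^+_a=\mathcal{L}^+\cap\mathcal{A}_a$. For $\theta\ge0$, $\Delta_\theta$ is the differential operator $(\Delta_\theta f)(z)=\theta f'(z)+zf''(z)$. For entire $\varphi,f$, $\varphi(\Delta_\theta)f$ is the function $\sum_{k=0}^\infty\sum_{m=0}^\infty \frac{\varphi^{(k)}(0)}{k!}\frac{f^{(m)}(0)}{m!}\Delta_\theta^k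 z^m$ (note $\Delta_\theta^k z^m$ is a constant multiple of $z^{m-k}$ for $k\le m$ and $0$ for $k>m$). *)

theory Defs
  imports "HOL-Analysis.Analysis"
begin

definition entire :: "(complex \<Rightarrow> complex) \<Rightarrow> bool" where
  "entire f \<longleftrightarrow> f holomorphic_on UNIV"

text \<open>The seminorm: sup over k of b^(-k) |f^(k)(0)|
  (meaningful when the sequence is bounded).\<close>
definition bnorm :: "real \<Rightarrow> (complex \<Rightarrow> complex) \<Rightarrow> real" where
  "bnorm b f = (SUP k. cmod ((deriv ^^ k) f 0) / b ^ k)"

definition Aspace :: "real \<Rightarrow> (complex \<Rightarrow> complex) set" where
  "Aspace a = {f. entire f \<and>
     (\<forall>b>a. bdd_above (range (\<lambda>k. cmod ((deriv ^^ k) f 0) / b ^ k)))}"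

definition Atop :: "real \<Rightarrow> (complex \<Rightarrow> complex) topology" where
  "Atop a = topology_generated_by
     {{g \<in> Aspace a. bnorm b (\<lambda>z. g z - f z) < e} | f b e. f \<in> Aspace a \<and> b > a \<and> e > 0}"

definition Lplus :: "(complex \<Rightarrow> complex) set" where
  "Lplus = {f. \<exists>(C::complex) (l::nat) (\<alpha>::real) (\<beta>::nat \<Rightarrow> real).
     \<alpha> \<ge> 0 \<and> (\<forall>j. \<beta> j \<ge> \<beta> (Suc j)) \<and> (\<forall>j. \<beta> j \<ge> 0) \<and> summable \<beta> \<and>
     (\<forall>z. f z = C * z ^ l * exp (complex_of_real \<alpha> * z) *
                 (\<Prod>j. 1 + complex_of_real (\<beta> j) * z))}"

definition Lplus_a :: "real \<Rightarrow> (complex \<Rightarrow> complex) set" where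
  "Lplus_a a = Lplus \<inter> Aspace a"

definition Delta :: "real \<Rightarrow> (complex \<Rightarrow> complex) \<Rightarrow> (complex \<Rightarrow> complex)" where
  "Delta \<theta> f = (\<lambda>z. complex_of_real \<theta> * deriv f z + z * deriv (deriv f) z)"

definition op_apply :: "real \<Rightarrow> (complex \<Rightarrow> complex) \<Rightarrow> (complex \<Rightarrow> complex) \<Rightarrow> (complex \<Rightarrow> complex)" where
  "op_apply \<theta> \<phi> f = (\<lambda>z. \<Sum>k. \<Sum>m.
      ((deriv ^^ k) \<phi> 0 / fact k) * ((deriv ^^ m) f 0 / fact m) *
      ((Delta \<theta> ^^ k) (\<lambda>w. w ^ m)) z)"

end

theory Submission
  imports Defs "HOL-Complex_Analysis.Complex_Analysis"
    "HOL-Computational_Algebra.Fundamental_Theorem_Algebra"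
begin

text \<open>
  The derivatives of \<open>g = \<phi>(\<Delta>\<^sub>\<theta>) f\<close> at \<open>0\<close> are
  \<open>g\<^sub>n = \<Sum>k. \<phi>\<^sub>k f\<^sub>n\<^sub>+\<^sub>k (\<theta> + n)\<^sub>k / k!\<close>, where \<open>\<phi>\<^sub>k\<close>, \<open>f\<^sub>k\<close> are the derivatives of \<open>\<phi>\<close>, \<open>f\<close>
  at \<open>0\<close> and \<open>(t)\<^sub>k\<close> is the rising factorial. The binomial series bounds the norm of \<open>g\<close> with parameter
  \<open>b/(1 - ab)\<close> by \<open>(1 - ab)\<close> to the power \<open>-\<theta>\<close> times the norms of \<open>\<phi>\<close> and \<open>f\<close> with parameters \<open>a\<close> and
  \<open>b\<close>; since the map is bilinear, this gives continuity.

  For polynomials with nonpositive zeros, \<open>\<phi>(\<Delta>\<^sub>\<theta>)\<close> is a composition of operators \<open>\<kappa> + \<Delta>\<^sub>\<theta>\<close> with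
  \<open>\<kappa> \<ge> 0\<close>, each of which preserves real-rootedness and nonnegativity of the coefficients. In general,
  up to a constant factor, \<open>\<phi>\<close> and \<open>f\<close> are approximated by such polynomials whose coefficients are
  dominated by theirs. All terms of the series above are then nonnegative, so the coefficients of the
  images converge to, and are dominated by, those of \<open>g\<close>. The reciprocals of the zeros of the images,
  sorted, have bounded sums; along a subsequence they converge, and the mass that escapes produces the
  exponential factor.
\<close>

unbundle no vec_syntax

subsection \<open>Real-rooted polynomials with nonnegative coefficients\<close>

definition cpoly :: "real poly \<Rightarrow> complex \<Rightarrow> complex" where
  "cpoly p z = poly (map_poly complex_of_real p) z"

lemma cpoly_0 [simp]: "cpoly 0 z = 0"
  and cpoly_pCons [simp]: "cpoly (pCons a p) z = of_real a + z * cpoly p z"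
  by (simp_all add: cpoly_def map_poly_pCons)

lemma cpoly_1 [simp]: "cpoly 1 z = 1"
  by (simp add: one_pCons)

lemma cpoly_add [simp]: "cpoly (p + q) z = cpoly p z + cpoly q z"
proof -
  have "map_poly complex_of_real (p + q) = map_poly of_real p + map_poly of_real q"
    by (rule poly_eqI) (simp add: coeff_map_poly)
  thus ?thesis by (simp add: cpoly_def)
qed

lemma cpoly_smult [simp]: "cpoly (smult c p) z = of_real c * cpoly p z"
  by (induction p) (simp_all add: algebra_simps)

lemma cpoly_minus [simp]: "cpoly (- p) z = - cpoly p z"
  using cpoly_smult[of "-1" p z] by simp

lemma cpoly_diff [simp]: "cpoly (p - q) z = cpoly p z - cpoly q z"
  using cpoly_add[of p "- q" z] by simp

lemma cpoly_mult [simp]: "cpoly (p * q) z = cpoly p z * cpoly q z"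
  by (induction p) (simp_all add: algebra_simps)

lemma cpoly_cnj: "cpoly p (cnj z) = cnj (cpoly p z)"
  by (induction p) simp_all

lemma cpoly_of_real: "cpoly p (of_real x) = of_real (poly p x)"
  by (induction p) simp_all

definition real_rooted :: "real poly \<Rightarrow> bool" where
  "real_rooted p \<longleftrightarrow> (\<forall>z. Im z \<noteq> 0 \<longrightarrow> cpoly p z \<noteq> 0)"

text \<open>Non-real zeros of a real polynomial come in conjugate pairs, so the upper half-plane
  suffices.\<close>

lemma real_rootedI:
  assumes "\<And>z. Im z > 0 \<Longrightarrow> cpoly p z \<noteq> 0"
  shows "real_rooted p"
  unfolding real_rooted_def
proof (intro allI impI)
  fix z :: complex assume "Im z \<noteq> 0"
  then consider "Im z > 0" | "Im (cnj z) > 0" by fastforce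
  thus "cpoly p z \<noteq> 0"
    using assms[of z] assms[of "cnj z"] by cases (simp_all add: cpoly_cnj)
qed

lemma real_rooted_nonzero: "real_rooted p \<Longrightarrow> p \<noteq> 0"
  unfolding real_rooted_def by (metis cpoly_0 imaginary_unit.sel(2) zero_neq_one)

lemma real_rooted_mult: "real_rooted p \<Longrightarrow> real_rooted q \<Longrightarrow> real_rooted (p * q)"
  and real_rooted_mult_left: "real_rooted (p * q) \<Longrightarrow> real_rooted q"
  by (auto simp: real_rooted_def)

lemma real_rooted_1: "real_rooted 1"
  by (simp add: real_rooted_def)

lemma real_rooted_power: "real_rooted p \<Longrightarrow> real_rooted (p ^ n)"
  by (induction n) (auto intro: real_rooted_mult real_rooted_1)

lemma real_rooted_linear: "a \<noteq> 0 \<or> b \<noteq> 0 \<Longrightarrow> real_rooted [:a, b:]"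
  by (auto simp: real_rooted_def complex_eq_iff)

lemma real_rooted_smult: "c \<noteq> 0 \<Longrightarrow> real_rooted p \<Longrightarrow> real_rooted (smult c p)"
  by (auto simp: real_rooted_def)

text \<open>The fundamental theorem of algebra gives a complex zero, which must be real; its linear
  factor splits off over the reals and the quotient inherits real-rootedness.\<close>

lemma real_rooted_factorization:
  assumes "real_rooted p"
  shows "\<exists>xs. p = smult (lead_coeff p) (\<Prod>x\<leftarrow>xs. [:- x, 1:])"
  using assms
proof (induction "degree p" arbitrary: p)
  case 0
  then obtain c where "p = [:c:]" by (metis degree_eq_zeroE)
  thus ?case by (intro exI[of _ "[]"]) simp
next
  case (Suc n)
  have "\<not> constant (poly (map_poly complex_of_real p))"
    using Suc.hyps(2) by (simp add: constant_degree degree_map_poly)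
  then obtain z where z: "cpoly p z = 0"
    using fundamental_theorem_of_algebra unfolding cpoly_def by blast
  hence "Im z = 0" using Suc.prems by (auto simp: real_rooted_def)
  then obtain x where x: "z = of_real x" by (metis complex_is_Real_iff Reals_cases)
  hence "poly p x = 0" using z by (simp add: cpoly_of_real)
  then obtain q where q: "p = [:- x, 1:] * q" by (metis dvdE poly_eq_0_iff_dvd)
  have "q \<noteq> 0" using q real_rooted_nonzero[OF Suc.prems] by auto
  hence "degree p = Suc (degree q)" unfolding q by (subst degree_mult_eq) auto
  moreover have "real_rooted q" using Suc.prems q real_rooted_mult_left by blast
  ultimately obtain xs where "q = smult (lead_coeff q) (\<Prod>x\<leftarrow>xs. [:- x, 1:])"
    using Suc.hyps by auto
  moreover have "lead_coeff p = lead_coeff q"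
    unfolding q by (subst lead_coeff_mult) simp
  ultimately have "p = smult (lead_coeff p) (\<Prod>x\<leftarrow>x # xs. [:- x, 1:])"
    by (metis (no_types, lifting) q list.simps(9) mult_smult_right prod_list.Cons)
  thus ?case by blast
qed

text \<open>The logarithmic derivative is the sum of \<open>1 / (z - x)\<close> over the zeros
  \<open>x\<close>, and each term has negative imaginary part in the upper half-plane.\<close>

lemma real_rooted_logderiv:
  assumes "real_rooted p" "Im z > 0" "degree p > 0"
  shows "Im (cpoly (pderiv p) z / cpoly p z) < 0"
proof -
  \<comment> \<open>The weak inequality covers the empty product, the strict one nonempty products;
    nonvanishing is carried along to allow division.\<close>
  have L: "Im (cpoly (pderiv q) z / cpoly q z) \<le> 0 \<and>
           (xs \<noteq> [] \<longrightarrow> Im (cpoly (pderiv q) z / cpoly q z) < 0) \<and> cpoly q z \<noteq> 0"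
    if "q = (\<Prod>x\<leftarrow>xs. [:- x, 1:])" for q xs
    using that
  proof (induction xs arbitrary: q)
    case Nil
    thus ?case by (simp add: one_pCons pderiv_pCons)
  next
    case (Cons x xs)
    define r where "r = (\<Prod>x\<leftarrow>xs. [:- x, 1:])"
    have q: "q = [:- x, 1:] * r" using Cons.prems by (simp add: r_def)
    have nz: "z - of_real x \<noteq> 0" using assms(2) by (auto simp: complex_eq_iff)
    have IH: "Im (cpoly (pderiv r) z / cpoly r z) \<le> 0" "cpoly r z \<noteq> 0"
      using Cons.IH[of r] by (auto simp: r_def)
    have "cpoly (pderiv q) z = (z - of_real x) * cpoly (pderiv r) z + cpoly r z"
      unfolding q by (subst pderiv_mult) (simp add: pderiv_pCons algebra_simps)
    moreover have cq: "cpoly q z = (z - of_real x) * cpoly r z"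
      unfolding q by (simp add: algebra_simps)
    ultimately have "cpoly (pderiv q) z / cpoly q z
        = 1 / (z - of_real x) + cpoly (pderiv r) z / cpoly r z"
      using nz IH by (simp add: divide_simps)
    moreover have "Im (1 / (z - of_real x)) < 0"
      using assms(2) by (simp add: Im_divide add_nonneg_pos)
    ultimately show ?case using IH cq nz by auto
  qed
  obtain xs where xs: "p = smult (lead_coeff p) (\<Prod>x\<leftarrow>xs. [:- x, 1:])"
    using real_rooted_factorization[OF assms(1)] by blast
  define q where "q = (\<Prod>x\<leftarrow>xs. [:- x, 1:])"
  have c: "lead_coeff p \<noteq> 0" using real_rooted_nonzero[OF assms(1)] by simp
  have p: "p = smult (lead_coeff p) q" using xs q_def by simp
  have eq: "cpoly (pderiv p) z / cpoly p z = cpoly (pderiv q) z / cpoly q z"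
    by (subst (1 2) p) (use c in \<open>simp add: pderiv_smult\<close>)
  have "degree q > 0" using assms(3) c by (subst (asm) p) simp
  hence "xs \<noteq> []" using q_def by auto
  thus ?thesis using L[OF q_def] eq by simp
qed

text \<open>Equivalently, all zeros are real and nonpositive and the leading coefficient is
  positive.\<close>

definition nonneg_hyperbolic :: "real poly \<Rightarrow> bool" where
  "nonneg_hyperbolic p \<longleftrightarrow> real_rooted p \<and> (\<forall>k. coeff p k \<ge> 0)"

lemma nonneg_coeffs_poly_pos:
  fixes p :: "real poly"
  assumes "\<And>k. coeff p k \<ge> 0" "p \<noteq> 0" "x > 0"
  shows "poly p x > 0"
proof -
  have "lead_coeff p > 0" using assms by (metis leading_coeff_neq_0 less_eq_real_def)
  thus ?thesis unfolding poly_altdef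
    using assms by (intro sum_pos2[of _ "degree p"]) auto
qed

text \<open>A nonzero polynomial with nonnegative coefficients is positive on the positive axis, so
  its real zeros are nonpositive.\<close>

lemma nonneg_hyperbolic_factorization:
  assumes "nonneg_hyperbolic p"
  obtains rs where "p = smult (lead_coeff p) (\<Prod>r\<leftarrow>rs. [:r, 1:])"
    "\<And>r. r \<in> set rs \<Longrightarrow> r \<ge> 0" "lead_coeff p > 0"
proof -
  have nz: "p \<noteq> 0" and rr: "real_rooted p" and c: "\<And>k. coeff p k \<ge> 0"
    using assms real_rooted_nonzero by (auto simp: nonneg_hyperbolic_def)
  obtain xs where xs: "p = smult (lead_coeff p) (\<Prod>x\<leftarrow>xs. [:- x, 1:])"
    using real_rooted_factorization[OF rr] by blast
  have "poly p x = 0" if "x \<in> set xs" for x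
    by (subst xs) (use that in \<open>induction xs, auto\<close>)
  hence "\<And>x. x \<in> set xs \<Longrightarrow> x \<le> 0"
    using nonneg_coeffs_poly_pos[OF c nz] by (metis less_irrefl not_le)
  moreover have "p = smult (lead_coeff p) (\<Prod>r\<leftarrow>map uminus xs. [:r, 1:])"
    by (subst xs) (simp add: o_def)
  moreover have "lead_coeff p > 0" using c nz by (metis leading_coeff_neq_0 less_eq_real_def)
  ultimately show ?thesis using that[of "map uminus xs"] by force
qed

text \<open>The quotient is the sum of \<open>z / (z + r)\<close> over the factors
  \<open>[:r, 1:]\<close>; a term has positive imaginary part if \<open>r > 0\<close> and equals
  \<open>1\<close> if \<open>r = 0\<close>. Only constant multiples of powers of \<open>z\<close>
  escape strictness, and these are eigenvectors of the Euler operator.\<close>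

lemma nonneg_hyperbolic_Euler_op:
  assumes "nonneg_hyperbolic p" "Im z > 0"
  shows "Im (z * cpoly (pderiv p) z / cpoly p z) > 0 \<or>
    (\<exists>n. pCons 0 (pderiv p) = smult (of_nat n) p)"
proof -
  obtain rs where rs: "p = smult (lead_coeff p) (\<Prod>r\<leftarrow>rs. [:r, 1:])"
    "\<And>r. r \<in> set rs \<Longrightarrow> r \<ge> 0" "lead_coeff p > 0"
    using nonneg_hyperbolic_factorization[OF assms(1)] by blast
  define c q where "c = lead_coeff p" and "q = (\<Prod>r\<leftarrow>rs. [:r, 1:])"
  have p: "p = smult c q" and c: "c > 0" using rs q_def c_def by simp_all
  have "(Im (z * cpoly (pderiv q) z / cpoly q z) > 0 \<or>
      (\<exists>n. pCons 0 (pderiv q) = smult (of_nat n) q)) \<and> cpoly q z \<noteq> 0"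
    using rs(2) unfolding q_def
  proof (induction rs)
    case Nil
    thus ?case by (auto simp: one_pCons pderiv_pCons intro!: exI[of _ 0])
  next
    case (Cons x xs)
    define r where "r = (\<Prod>x\<leftarrow>xs. [:x, 1:])"
    define q where "q = [:x, 1:] * r"
    have nz: "z + of_real x \<noteq> 0" using assms(2) by (auto simp: complex_eq_iff)
    have IH: "Im (z * cpoly (pderiv r) z / cpoly r z) > 0 \<or>
      (\<exists>n. pCons 0 (pderiv r) = smult (of_nat n) r)" "cpoly r z \<noteq> 0"
      using Cons by (auto simp: r_def)
    have IH': "Im (z * cpoly (pderiv r) z / cpoly r z) \<ge> 0"
    proof -
      have "z * cpoly (pderiv r) z / cpoly r z = of_real (of_nat n)"
        if "pCons 0 (pderiv r) = smult (of_nat n) r" for n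
        using arg_cong[OF that, of "\<lambda>p. cpoly p z"] IH(2) by (simp add: divide_simps)
      thus ?thesis using IH(1) by fastforce
    qed
    have dq: "pderiv q = [:x, 1:] * pderiv r + r"
      unfolding q_def by (subst pderiv_mult) (simp add: pderiv_pCons)
    have cq: "cpoly q z = (z + of_real x) * cpoly r z"
      unfolding q_def by (simp add: algebra_simps)
    have eq: "z * cpoly (pderiv q) z / cpoly q z
        = z / (z + of_real x) + z * cpoly (pderiv r) z / cpoly r z"
      using nz IH cq dq by (simp add: divide_simps) (simp add: algebra_simps)
    have eq2: "Im (z / (z + of_real x)) = x * Im z / ((Re z + x)\<^sup>2 + (Im z)\<^sup>2)"
      by (simp add: Im_divide algebra_simps)
    have "0 < (Re z + x)\<^sup>2 + (Im z)\<^sup>2"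
      using assms(2) by (simp add: add_nonneg_pos)
    \<comment> \<open>A factor with \<open>x = 0\<close> adds the real number \<open>1\<close> and
      leaves the imaginary part unchanged; one with \<open>x > 0\<close> makes it strictly
      positive.\<close>
    have *: "Im (z * cpoly (pderiv q) z / cpoly q z) > 0 \<or>
         x = 0 \<and> (\<exists>n. pCons 0 (pderiv r) = smult (of_nat n) r)"
    proof (cases "x = 0")
      case False
      hence "x > 0" using Cons.prems by (simp add: order_less_le)
      hence "x * Im z / ((Re z + x)\<^sup>2 + (Im z)\<^sup>2) > 0"
        using assms(2) \<open>0 < (Re z + x)\<^sup>2 + (Im z)\<^sup>2\<close> by simp
      thus ?thesis using eq eq2 IH' by simp
    qed (use IH eq eq2 in auto)
    have "\<exists>n. pCons 0 (pderiv q) = smult (of_nat n) q"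
      if "x = 0" and n: "pCons 0 (pderiv r) = smult (of_nat n) r" for n
    proof -
      have "pderiv q = smult (of_nat (Suc n)) r"
        using dq that by (simp add: smult_add_left)
      hence "pCons 0 (pderiv q) = smult (of_nat (Suc n)) q"
        using that(1) by (simp add: q_def)
      thus ?thesis by blast
    qed
    thus ?case using * cq nz IH(2) by (auto simp: q_def r_def)
  qed
  moreover have "z * cpoly (pderiv p) z / cpoly p z = z * cpoly (pderiv q) z / cpoly q z"
    unfolding p using c by (simp add: pderiv_smult)
  moreover have "pCons 0 (pderiv p) = smult c (pCons 0 (pderiv q))"
    unfolding p by (simp add: pderiv_smult)
  ultimately show ?thesis unfolding p
    by (metis smult_smult mult.commute)
qed

section \<open>The operator \<open>Delta\<close> on real polynomials\<close>

definition Delta_poly :: "real \<Rightarrow> real poly \<Rightarrow> real poly" where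
  "Delta_poly \<theta> p = smult \<theta> (pderiv p) + pCons 0 (pderiv (pderiv p))"

lemma coeff_Delta_poly:
  "coeff (Delta_poly \<theta> p) n = of_nat (Suc n) * (\<theta> + of_nat n) * coeff p (Suc n)"
  by (cases n) (simp_all add: Delta_poly_def coeff_pderiv algebra_simps)

lemma Delta_poly_add: "Delta_poly \<theta> (p + q) = Delta_poly \<theta> p + Delta_poly \<theta> q"
  and Delta_poly_smult: "Delta_poly \<theta> (smult c p) = smult c (Delta_poly \<theta> p)"
  by (rule poly_eqI; simp add: coeff_Delta_poly algebra_simps)+

text \<open>With \<open>v = z p' + (\<theta> - 1) p\<close> one has \<open>\<kappa> p + \<Delta> p = \<kappa> p + v'\<close>. In the upper half-plane
  \<open>v/p\<close> has nonnegative imaginary part, so \<open>v\<close> is real-rooted and both \<open>p/v\<close> and \<open>v'/v\<close> have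
  nonpositive imaginary part, strictly so for the latter.\<close>
lemma nonneg_hyperbolic_Delta:
  assumes p: "nonneg_hyperbolic p" and "\<kappa> \<ge> 0" "\<theta> \<ge> 0"
    and nz: "smult \<kappa> p + Delta_poly \<theta> p \<noteq> 0"
  shows "nonneg_hyperbolic (smult \<kappa> p + Delta_poly \<theta> p)"
proof -
  define v where "v = pCons 0 (pderiv p) + smult (\<theta> - 1) p"
  have rr: "real_rooted p" and c: "\<And>k. coeff p k \<ge> 0"
    using p by (auto simp: nonneg_hyperbolic_def)
  have pnz: "cpoly p z \<noteq> 0" if "Im z > 0" for z
    using rr that by (auto simp: real_rooted_def)
  have dv: "Delta_poly \<theta> p = pderiv v"
    by (simp add: v_def Delta_poly_def pderiv_add pderiv_diff pderiv_smult pderiv_pCons smult_diff_left)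
  have vp: "cpoly v z / cpoly p z = z * cpoly (pderiv p) z / cpoly p z + of_real (\<theta> - 1)"
    if "Im z > 0" for z
    using pnz[OF that] by (simp add: v_def add_divide_distrib)
  have vmon: "v = smult (of_nat n + \<theta> - 1) p" if "pCons 0 (pderiv p) = smult (of_nat n) p" for n
    using that by (simp add: v_def smult_add_left smult_diff_left)
  have Imvp: "Im (cpoly v z / cpoly p z) > 0 \<or> (\<exists>d. v = smult d p)" if "Im z > 0" for z
    using nonneg_hyperbolic_Euler_op[OF p that] vp[OF that] vmon by auto
  have "real_rooted (smult \<kappa> p + pderiv v)"
  proof (cases "degree v = 0")
    case True
    \<comment> \<open>Only \<open>smult \<kappa> p\<close> remains, and \<open>nz\<close> rules out
      \<kappa> = 0.\<close>
    hence "pderiv v = 0" by (simp add: pderiv_eq_0_iff)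
    thus ?thesis using nz dv rr by (auto intro!: real_rooted_smult)
  next
    case False
    have v: "real_rooted v"
    \<comment> \<open>For \<open>v = smult d p\<close> the quotient v/p is real and gives no strict
      sign; there \<open>d\<close> is nonzero because \<open>v\<close> is not constant.\<close>
    proof (cases "\<exists>d. v = smult d p")
      case True
      thus ?thesis using False rr by (auto intro!: real_rooted_smult)
    next
      case ndm: False
      show ?thesis by (rule real_rootedI) (use Imvp ndm in force)
    qed
    show ?thesis
    proof (rule real_rootedI)
      fix z :: complex assume z: "Im z > 0"
      have vnz: "cpoly v z \<noteq> 0" using v z by (auto simp: real_rooted_def)
      have "Im (cpoly p z / cpoly v z) \<le> 0"
      proof (cases "\<exists>d. v = smult d p")
        case True
        then obtain d where "v = smult d p" by blast
        hence "cpoly p z / cpoly v z = of_real (1 / d)"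
          using vnz pnz[OF z] by simp
        thus ?thesis by (metis Im_complex_of_real order_refl)
      next
        case ndm: False
        define w where "w = cpoly v z / cpoly p z"
        have "Im w > 0" using Imvp[OF z] ndm w_def by auto
        hence "Im (1 / w) \<le> 0" by (simp add: Im_divide)
        thus ?thesis by (simp add: w_def)
      qed
      hence "Im (of_real \<kappa> * (cpoly p z / cpoly v z)) \<le> 0"
        using assms(2) by (simp only: Im_complex_of_real Re_complex_of_real times_complex.sel)
          (simp add: mult_nonneg_nonpos)
      moreover have "Im (cpoly (pderiv v) z / cpoly v z) < 0"
        using real_rooted_logderiv[OF v z] False by simp
      ultimately have "Im (of_real \<kappa> * (cpoly p z / cpoly v z) + cpoly (pderiv v) z / cpoly v z) < 0"
        by simp
      moreover have "of_real \<kappa> * (cpoly p z / cpoly v z) + cpoly (pderiv v) z / cpoly v z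
        = cpoly (smult \<kappa> p + pderiv v) z / cpoly v z"
        by (simp add: add_divide_distrib)
      ultimately show "cpoly (smult \<kappa> p + pderiv v) z \<noteq> 0" by (metis div_0 less_irrefl zero_complex.sel(2))
    qed
  qed
  thus ?thesis
    using c assms(2,3) by (auto simp: nonneg_hyperbolic_def coeff_Delta_poly simp flip: dv)
qed

section \<open>Polynomials in the operator\<close>

lemma smult_sum_right: "smult (c :: real) (sum f A) = (\<Sum>x\<in>A. smult c (f x))"
  by (rule poly_eqI) (simp add: coeff_sum sum_distrib_left)

text \<open>One application at index \<open>j\<close> contributes
  \<open>(j + 1) * (\<theta> + j)\<close>; for \<open>j\<close> from \<open>n\<close> to
  \<open>n + k - 1\<close> these multiply to a quotient of factorials and a rising
  factorial.\<close>

lemma coeff_Delta_poly_funpow: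
  "coeff ((Delta_poly \<theta> ^^ k) p) n =
     fact (n + k) / fact n * pochhammer (\<theta> + of_nat n) k * coeff p (n + k)"
proof (induction k arbitrary: n)
  case (Suc k)
  have "real (Suc n) / fact (Suc n) = 1 / fact n"
    by (simp add: divide_simps)
  hence "real (Suc n) * (\<theta> + real n) * (fact (Suc n + k) / fact (Suc n) * P * C) =
      fact (n + Suc k) / fact n * ((\<theta> + real n) * P) * C" for P C
    by (simp del: fact_Suc of_nat_Suc add: field_simps)
  moreover have "\<theta> + real (Suc n) = \<theta> + real n + 1" by simp
  ultimately show ?case
    by (simp del: fact_Suc of_nat_Suc add: coeff_Delta_poly Suc pochhammer_rec
        \<open>\<theta> + real (Suc n) = \<theta> + real n + 1\<close>)
qed simp

text \<open>Counterpart of \<open>op_apply\<close> for polynomials, with finite sums only.\<close>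

definition op_poly :: "real \<Rightarrow> real poly \<Rightarrow> real poly \<Rightarrow> real poly" where
  "op_poly \<theta> p q = (\<Sum>k\<le>degree p. smult (coeff p k) ((Delta_poly \<theta> ^^ k) q))"

lemma op_poly_altdef:
  assumes "degree p \<le> N"
  shows "op_poly \<theta> p q = (\<Sum>k\<le>N. smult (coeff p k) ((Delta_poly \<theta> ^^ k) q))"
  unfolding op_poly_def using assms
  by (intro sum.mono_neutral_left) (auto simp: coeff_eq_0)

text \<open>Written as an infinite series with finitely many nonzero terms, so that Tannery's
  theorem can pass to the limit in \<open>p\<close> and \<open>q\<close>.\<close>

lemma coeff_op_poly:
  "coeff (op_poly \<theta> p q) n = (\<Sum>k. coeff p k * coeff q (n + k) *
     (fact (n + k) / fact n) * pochhammer (\<theta> + of_nat n) k)"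
  by (subst suminf_finite[of "{..degree p}"])
     (auto simp: op_poly_def coeff_sum coeff_Delta_poly_funpow coeff_eq_0 mult_ac)

text \<open>Multiplying polynomials corresponds to composing operators; one linear factor is all
  that the induction over the zeros of \<open>p\<close> needs.\<close>

lemma op_poly_linear_mult:
  "op_poly \<theta> ([:r, 1:] * p) q = smult r (op_poly \<theta> p q) + Delta_poly \<theta> (op_poly \<theta> p q)"
proof -
  define D where "D = (\<lambda>k. (Delta_poly \<theta> ^^ k) q)"
  have Delta_sum: "Delta_poly \<theta> (sum f A) = (\<Sum>k\<in>A. Delta_poly \<theta> (f k))"
    if "finite A" for A :: "nat set" and f
    using that by induction (auto simp: Delta_poly_add, simp add: Delta_poly_def)
  have "op_poly \<theta> ([:r, 1:] * p) q =
      (\<Sum>k\<le>Suc (degree p). smult (coeff ([:r, 1:] * p) k) (D k))"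
    unfolding D_def by (rule op_poly_altdef) (use degree_mult_le[of "[:r, 1:]" p] in simp)
  also have "\<dots> = (\<Sum>k\<le>Suc (degree p). smult r (smult (coeff p k) (D k)))
      + (\<Sum>k\<le>Suc (degree p). smult (coeff (pCons 0 p) k) (D k))"
    by (simp add: sum.distrib[symmetric] smult_add_left)
  also have "(\<Sum>k\<le>Suc (degree p). smult (coeff (pCons 0 p) k) (D k)) =
      (\<Sum>k\<le>degree p. smult (coeff p k) (D (Suc k)))"
    by (subst sum.atMost_Suc_shift) simp
  also have "\<dots> = Delta_poly \<theta> (op_poly \<theta> p q)"
    by (simp add: op_poly_def Delta_sum Delta_poly_smult D_def)
  also have "(\<Sum>k\<le>Suc (degree p). smult r (smult (coeff p k) (D k))) = smult r (op_poly \<theta> p q)"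
    using op_poly_altdef[of p "Suc (degree p)" \<theta> q] unfolding D_def
    by (simp add: smult_sum_right del: sum.atMost_Suc)
  finally show ?thesis .
qed

lemma nonneg_hyperbolic_op_poly:
  assumes "nonneg_hyperbolic p" "nonneg_hyperbolic q" "\<theta> \<ge> 0" "op_poly \<theta> p q \<noteq> 0"
  shows "nonneg_hyperbolic (op_poly \<theta> p q)"
proof -
  obtain rs where rs: "p = smult (lead_coeff p) (\<Prod>r\<leftarrow>rs. [:r, 1:])"
    "\<And>r. r \<in> set rs \<Longrightarrow> r \<ge> 0" "lead_coeff p > 0"
    using nonneg_hyperbolic_factorization[OF assms(1)] by blast
  define c p' where "c = lead_coeff p" and "p' = (\<Prod>r\<leftarrow>rs. [:r, 1:])"
  have p: "p = smult c p'" and c: "c > 0" using rs by (simp_all add: c_def p'_def)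
  have eq: "op_poly \<theta> p q = smult c (op_poly \<theta> p' q)"
    unfolding p using c by (simp add: op_poly_def smult_sum_right)
  \<comment> \<open>Intermediate results may vanish, since \<open>Delta_poly\<close> lowers degrees;
    from then on the result stays zero.\<close>
  have "op_poly \<theta> p' q = 0 \<or> nonneg_hyperbolic (op_poly \<theta> p' q)"
    using rs(2) unfolding p'_def
  proof (induction rs)
    case Nil
    thus ?case using assms(2) by (simp add: op_poly_def)
  next
    case (Cons r rs)
    thus ?case
      using nonneg_hyperbolic_Delta[of "op_poly \<theta> (\<Prod>r\<leftarrow>rs. [:r, 1:]) q" r \<theta>] assms(3)
      by (auto simp: op_poly_linear_mult simp del: mult_pCons_left)
         (auto simp: Delta_poly_def)
  qed
  thus ?thesis using eq assms(4) c
    by (auto simp: nonneg_hyperbolic_def intro!: real_rooted_smult)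
qed

subsection \<open>Polynomial approximation of Laguerre functions\<close>

text \<open>On the disc the factors deviate from \<open>1\<close> by at most
  \<open>\<beta> j * r\<close>, which is a summable majorant.\<close>

lemma uniform_limit_prod_linear_factors:
  fixes \<beta> :: "nat \<Rightarrow> real"
  assumes "summable \<beta>" "\<And>j. \<beta> j \<ge> 0"
  shows "uniform_limit (cball 0 r) (\<lambda>N z. \<Prod>j<N. 1 + complex_of_real (\<beta> j) * z)
     (\<lambda>z. \<Prod>j. 1 + complex_of_real (\<beta> j) * z) sequentially"
proof -
  have "uniformly_convergent_on (cball 0 r) (\<lambda>N z. \<Prod>j<N. 1 + complex_of_real (\<beta> j) * z)"
  proof (rule uniformly_convergent_on_prod)
    show "uniformly_convergent_on (cball 0 r) (\<lambda>N z. \<Sum>n<N. norm (complex_of_real (\<beta> n) * z))"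
    proof (rule Weierstrass_m_test')
      show "summable (\<lambda>n. \<beta> n * r)" using assms(1) by (rule summable_mult2)
    qed (use assms(2) in \<open>auto simp: norm_mult intro!: mult_left_mono\<close>)
  qed (auto intro!: continuous_intros)
  then obtain g where g: "uniform_limit (cball 0 r)
      (\<lambda>N z. \<Prod>j<N. 1 + complex_of_real (\<beta> j) * z) g sequentially"
    by (auto simp: uniformly_convergent_on_def)
  \<comment> \<open>The uniform limit is the value of the infinite product;
    \<open>convergent_prod\<close> holds even at points where some factors vanish.\<close>
  have "g z = (\<Prod>j. 1 + complex_of_real (\<beta> j) * z)" if "z \<in> cball 0 r" for z
  proof -
    have "summable (\<lambda>i. norm (1 + complex_of_real (\<beta> i) * z - 1))"
      using assms by (auto simp: norm_mult intro: summable_mult2)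
    hence "convergent_prod (\<lambda>j. 1 + complex_of_real (\<beta> j) * z)"
      by (intro abs_convergent_prod_imp_convergent_prod summable_imp_abs_convergent_prod)
    hence "(\<lambda>n. \<Prod>i<n. 1 + complex_of_real (\<beta> i) * z) \<longlonglongrightarrow>
        (\<Prod>j. 1 + complex_of_real (\<beta> j) * z)"
      using convergent_prod_LIMSEQ LIMSEQ_lessThan_iff_atMost[of "\<lambda>A. prod _ A"] by blast
    moreover have "(\<lambda>n. \<Prod>i<n. 1 + complex_of_real (\<beta> i) * z) \<longlonglongrightarrow> g z"
      using g that by (rule tendsto_uniform_limitI)
    ultimately show ?thesis by (metis LIMSEQ_unique)
  qed
  thus ?thesis using g by (metis (no_types, lifting) uniform_limit_cong')
qed

lemma holomorphic_prod_linear_factors: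
  fixes \<beta> :: "nat \<Rightarrow> real"
  assumes "summable \<beta>" "\<And>j. \<beta> j \<ge> 0"
  shows "(\<lambda>z. \<Prod>j. 1 + complex_of_real (\<beta> j) * z) holomorphic_on UNIV"
proof (rule holomorphic_uniform_sequence[of _ "\<lambda>N z. \<Prod>j<N. 1 + complex_of_real (\<beta> j) * z"])
  fix x :: complex
  show "\<exists>d>0. cball x d \<subseteq> UNIV \<and> uniform_limit (cball x d)
      (\<lambda>N z. \<Prod>j<N. 1 + complex_of_real (\<beta> j) * z)
      (\<lambda>z. \<Prod>j. 1 + complex_of_real (\<beta> j) * z) sequentially"
  proof (intro exI[of _ 1] conjI uniform_limit_on_subset[OF uniform_limit_prod_linear_factors[OF assms]])
    show "cball x 1 \<subseteq> cball 0 (norm x + 1)"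
      by (auto simp: dist_norm) (metis add.commute add_left_mono diff_add_cancel norm_minus_commute norm_triangle_ineq order_trans)
  qed auto
qed (auto intro!: holomorphic_intros)

text \<open>Nonnegativity and domination make \<open>F\<close> a majorant for Tannery's theorem
  wherever a limit is taken inside a series. The limit is a formal power series because only
  coefficients are compared.\<close>

definition dominated_approx :: "(nat \<Rightarrow> real poly) \<Rightarrow> real fps \<Rightarrow> bool" where
  "dominated_approx p F \<longleftrightarrow> (\<forall>k. (\<forall>N. 0 \<le> coeff (p N) k \<and> coeff (p N) k \<le> fps_nth F k) \<and>
     (\<lambda>N. coeff (p N) k) \<longlonglongrightarrow> fps_nth F k)"

text \<open>Coefficients of a product are finite sums of products of nonnegative numbers. The power
  of \<open>z\<close>, the exponential and the infinite product can thus be approximated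
  separately.\<close>

lemma dominated_approx_mult:
  assumes "dominated_approx p F" "dominated_approx q G"
  shows "dominated_approx (\<lambda>N. p N * q N) (F * G)"
  unfolding dominated_approx_def coeff_mult fps_mult_nth atLeast0AtMost
  using assms unfolding dominated_approx_def
  by (auto intro!: sum_nonneg sum_mono mult_mono tendsto_intros intro: order_trans)

lemma dominated_approx_monom: "dominated_approx (\<lambda>_. monom 1 l) (fps_X ^ l)"
  by (auto simp: dominated_approx_def)

text \<open>The coefficients of the approximant are \<open>\<alpha> ^ k\<close> times
  \<open>(N choose k) / N ^ k\<close>, which is at most \<open>1 / fact k\<close> and tends to
  it.\<close>

lemma dominated_approx_exp:
  assumes "\<alpha> \<ge> 0"
  shows "dominated_approx (\<lambda>N. [:1, \<alpha> / real N:] ^ N) (fps_exp \<alpha>)"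
proof -
  have c: "coeff ([:1, \<alpha> / real N:] ^ N) k = real (N choose k) / real N ^ k * \<alpha> ^ k" for N k
  proof (cases "k \<le> N")
    case False
    have "degree ([:1, \<alpha> / real N:] ^ N) \<le> 1 * N"
      by (rule order_trans[OF degree_power_le mult_right_mono]) auto
    thus ?thesis using False by (simp add: coeff_eq_0)
  qed (simp add: coeff_linear_poly_power power_divide)
  \<comment> \<open>This recursion in \<open>k\<close> yields both the bound and the limit by
    induction.\<close>
  have step: "real (N choose Suc k) / real N ^ Suc k =
      real (N choose k) / real N ^ k * ((1 - real k / real N) / real (Suc k))" if "N > 0" for N k
  proof -
    have "real (Suc k) * real (N choose Suc k) = (real N - real k) * real (N choose k)"
    proof (cases "k \<le> N")
      case True
      have "Suc k * (N choose Suc k) = (N - k) * (N choose k)"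
        by (simp only: binomial_absorption binomial_absorb_comp)
      hence "real (Suc k * (N choose Suc k)) = real ((N - k) * (N choose k))"
        by simp
      thus ?thesis using True by (simp only: of_nat_mult of_nat_diff)
    qed (simp add: binomial_eq_0)
    hence "real (N choose Suc k) = (real N - real k) * real (N choose k) / real (Suc k)"
      by (simp add: eq_divide_eq mult.commute del: of_nat_Suc)
    moreover have "1 - real k / real N = (real N - real k) / real N"
      using that by (simp add: diff_divide_distrib)
    ultimately show ?thesis by (simp add: mult_ac)
  qed
  have bd: "real (N choose k) / real N ^ k \<le> 1 / fact k" for N k
  proof (cases "N = 0")
    case False
    thus ?thesis
    proof (induction k)
      case (Suc k)
      have "real (N choose Suc k) / real N ^ Suc k \<le> 1 / fact k * (1 / real (Suc k))"
      \<comment> \<open>For \<open>k > N\<close> the factor \<open>1 - k / N\<close> is negative,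
        but then the binomial coefficient on the left is zero.\<close>
      proof (cases "k \<le> N")
        case True
        have "real (N choose Suc k) / real N ^ Suc k =
           real (N choose k) / real N ^ k * ((1 - real k / real N) / real (Suc k))"
          using step Suc.prems by simp
        also have "\<dots> \<le> 1 / fact k * (1 / real (Suc k))"
          using Suc True by (intro mult_mono divide_right_mono) (auto simp: divide_simps)
        finally show ?thesis .
      qed (simp add: binomial_eq_0)
      thus ?case by (simp add: mult_ac)
    qed simp
  qed (cases k; simp)
  have lim: "(\<lambda>N. real (N choose k) / real N ^ k) \<longlonglongrightarrow> 1 / fact k" for k
  proof (induction k)
    case (Suc k)
    have "(\<lambda>N. real (N choose k) / real N ^ k * ((1 - real k / real N) / real (Suc k)))
        \<longlonglongrightarrow> 1 / fact k * ((1 - 0) / real (Suc k))"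
      by (intro tendsto_intros Suc lim_const_over_n) simp_all
    also have "1 / fact k * ((1 - 0) / real (Suc k)) = 1 / fact (Suc k)"
      by (simp add: mult_ac)
    finally show ?case
      by (rule Lim_transform_eventually)
         (use eventually_gt_at_top[of 0] in eventually_elim, simp only: step)
  qed simp
  show ?thesis unfolding dominated_approx_def c
    using assms bd tendsto_mult[OF lim tendsto_const[of "\<alpha> ^ _"]]
      mult_right_mono[OF bd, of "\<alpha> ^ _"] by simp
qed

lemma has_fps_expansion_cpoly:
  "cpoly p has_fps_expansion Abs_fps (\<lambda>k. of_real (coeff p k))"
proof (rule has_fps_expansionI, rule always_eventually, rule allI)
  fix z
  have "(\<lambda>n. complex_of_real (coeff p n) * z ^ n) sums (\<Sum>n\<le>degree p. of_real (coeff p n) * z ^ n)"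
    by (rule sums_finite) (auto simp: coeff_eq_0)
  thus "(\<lambda>n. Abs_fps (\<lambda>k. complex_of_real (coeff p k)) $ n * z ^ n) sums cpoly p z"
    by (simp add: cpoly_def poly_altdef coeff_map_poly degree_map_poly)
qed

text \<open>Each new factor has nonnegative coefficients and constant term \<open>1\<close>, so the
  coefficients of the partial products increase; uniform convergence near the origin identifies
  their limits as the Taylor coefficients of the product.\<close>

lemma dominated_approx_prod:
  fixes \<beta> :: "nat \<Rightarrow> real"
  assumes "summable \<beta>" "\<And>j. \<beta> j \<ge> 0"
  obtains F where "dominated_approx (\<lambda>N. \<Prod>j<N. [:1, \<beta> j:]) F"
    "(\<lambda>z. \<Prod>j. 1 + complex_of_real (\<beta> j) * z) has_fps_expansion Abs_fps (\<lambda>k. of_real (F $ k))"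
proof -
  define Q where "Q = (\<lambda>N. \<Prod>j<N. [:1, \<beta> j:])"
  define P where "P = (\<lambda>z. \<Prod>j. 1 + complex_of_real (\<beta> j) * z)"
  have Q: "cpoly (Q N) = (\<lambda>z. \<Prod>j<N. 1 + complex_of_real (\<beta> j) * z)" for N
    unfolding Q_def by (rule ext, induction N) (simp_all add: algebra_simps)
  have hP: "P holomorphic_on UNIV"
    unfolding P_def by (rule holomorphic_prod_linear_factors[OF assms])
  have nn: "coeff (Q N) k \<ge> 0" for N k
    unfolding Q_def
    by (induction N arbitrary: k)
       (auto simp: assms(2) coeff_pCons split: nat.splits)
  have "coeff (Q N) k \<le> coeff (Q (Suc N)) k" for N k
    using nn[of N] assms(2) by (simp add: Q_def coeff_pCons mult.commute[of _ "[:_, _:]"] split: nat.splits)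
  hence inc: "incseq (\<lambda>N. coeff (Q N) k)" for k
    by (rule incseq_SucI)
  have lim: "(\<lambda>N. complex_of_real (coeff (Q N) k)) \<longlonglongrightarrow> (deriv ^^ k) P 0 / fact k" for k
  proof -
    have "(\<lambda>N. (deriv ^^ k) (cpoly (Q N)) 0) \<longlonglongrightarrow> (deriv ^^ k) P 0"
    proof (rule higher_deriv_complex_uniform_limit)
      show "uniform_limit (ball 0 1) (\<lambda>N. cpoly (Q N)) P sequentially"
        using uniform_limit_on_subset[OF uniform_limit_prod_linear_factors[OF assms, of 1], of "ball 0 1"]
        unfolding Q P_def by auto
    qed (auto simp: Q intro!: always_eventually holomorphic_intros)
    hence "(\<lambda>N. (deriv ^^ k) (cpoly (Q N)) 0 / fact k) \<longlonglongrightarrow> (deriv ^^ k) P 0 / fact k"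
      by (intro tendsto_intros) auto
    thus ?thesis
      using fps_nth_fps_expansion[OF has_fps_expansion_cpoly] by simp
  qed
  \<comment> \<open>Taking real parts loses nothing: as limits of real coefficients, these Taylor
    coefficients are real.\<close>
  define F where "F = Abs_fps (\<lambda>k. Re ((deriv ^^ k) P 0 / fact k))"
  have limF: "(\<lambda>N. coeff (Q N) k) \<longlonglongrightarrow> F $ k" for k
    using tendsto_Re[OF lim[of k]] by (simp add: F_def)
  hence F: "of_real (F $ k) = (deriv ^^ k) P 0 / fact k" for k
    using LIMSEQ_unique[OF tendsto_of_real[OF limF] lim[of k]] by simp
  show ?thesis
  proof (rule that[of F])
    show "dominated_approx (\<lambda>N. \<Prod>j<N. [:1, \<beta> j:]) F"
      unfolding dominated_approx_def Q_def[symmetric]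
      using nn limF incseq_le[OF inc limF] by (auto simp: Q_def)
    have "P has_fps_expansion fps_expansion P 0"
      using hP by (intro has_fps_expansion_fps_expansion[of UNIV]) auto
    also have "fps_expansion P 0 = Abs_fps (\<lambda>k. of_real (F $ k))"
      by (rule fps_ext) (simp add: F fps_expansion_def)
    finally show "(\<lambda>z. \<Prod>j. 1 + complex_of_real (\<beta> j) * z)
        has_fps_expansion Abs_fps (\<lambda>k. of_real (F $ k))"
      by (simp add: P_def)
  qed
qed

text \<open>The approximants replace the exponential by \<open>[:1, \<alpha> / real N:] ^ N\<close>
  and truncate the product, so their zeros are real. The complex factor \<open>C\<close> is kept
  apart so that \<open>F\<close> has nonnegative real coefficients.\<close>

lemma Lplus_dominated_approx:
  assumes "f \<in> Lplus" "f \<noteq> (\<lambda>_. 0)"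
  obtains C F p where "C \<noteq> 0" "\<And>k. (deriv ^^ k) f 0 / fact k = C * of_real (F $ k)"
    "dominated_approx p F" "\<And>N. nonneg_hyperbolic (p N)"
proof -
  obtain C l \<alpha> \<beta> where *: "\<alpha> \<ge> 0" "\<And>j. \<beta> j \<ge> 0" "summable \<beta>"
     and f: "\<And>z. f z = C * z ^ l * exp (complex_of_real \<alpha> * z) *
                 (\<Prod>j. 1 + complex_of_real (\<beta> j) * z)"
    using assms(1) unfolding Lplus_def by blast
  obtain G where G: "dominated_approx (\<lambda>N. \<Prod>j<N. [:1, \<beta> j:]) G"
    "(\<lambda>z. \<Prod>j. 1 + complex_of_real (\<beta> j) * z) has_fps_expansion Abs_fps (\<lambda>k. of_real (G $ k))"
    using dominated_approx_prod[OF *(3,2)] by blast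
  define F where "F = fps_X ^ l * fps_exp \<alpha> * G"
  define p where "p = (\<lambda>N. monom 1 l * [:1, \<alpha> / real N:] ^ N * (\<Prod>j<N. [:1, \<beta> j:]))"
  have of_real_mult: "Abs_fps (\<lambda>k. complex_of_real ((A * B) $ k)) =
     Abs_fps (\<lambda>k. of_real (A $ k)) * Abs_fps (\<lambda>k. of_real (B $ k))" for A B
    by (rule fps_ext) (simp add: fps_mult_nth)
  have "f has_fps_expansion fps_const C * fps_X ^ l * fps_exp (of_real \<alpha>) * Abs_fps (\<lambda>k. of_real (G $ k))"
    unfolding f[abs_def] by (intro fps_expansion_intros G)
  also have "fps_const C * fps_X ^ l * fps_exp (of_real \<alpha>) * Abs_fps (\<lambda>k. complex_of_real (G $ k)) =
     fps_const C * Abs_fps (\<lambda>k. of_real (F $ k))"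
  proof -
    have "fps_X ^ l = Abs_fps (\<lambda>k. complex_of_real ((fps_X ^ l :: real fps) $ k))"
      "fps_exp (of_real \<alpha>) = Abs_fps (\<lambda>k. complex_of_real (fps_exp \<alpha> $ k))"
      by (rule fps_ext; simp)+
    thus ?thesis unfolding F_def of_real_mult by (simp add: mult.assoc)
  qed
  finally have fexp: "f has_fps_expansion fps_const C * Abs_fps (\<lambda>k. of_real (F $ k))" .
  show ?thesis
  proof (rule that[of C F p])
    show "C \<noteq> 0" using f assms(2) by auto
    show "(deriv ^^ k) f 0 / fact k = C * of_real (F $ k)" for k
      using fps_nth_fps_expansion[OF fexp, of k] by simp
    show d: "dominated_approx p F"
      unfolding p_def F_def
      by (intro dominated_approx_mult dominated_approx_monom dominated_approx_exp G *)
    show "nonneg_hyperbolic (p N)" for N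
      unfolding nonneg_hyperbolic_def
    proof
      have "real_rooted (\<Prod>j<N. [:1, \<beta> j:])"
        by (induction N) (auto intro!: real_rooted_1 real_rooted_mult real_rooted_linear simp del: mult_pCons_right)
      moreover have "real_rooted (monom 1 l)"
        by (simp add: monom_altdef real_rooted_power real_rooted_linear)
      ultimately show "real_rooted (p N)" unfolding p_def
        by (intro real_rooted_mult real_rooted_power real_rooted_linear) auto
    qed (use d in \<open>auto simp: dominated_approx_def\<close>)
  qed
qed

subsection \<open>Limits of polynomials with nonpositive zeros\<close>

lemma entire_power_series:
  fixes c :: "nat \<Rightarrow> complex"
  assumes "\<And>z. summable (\<lambda>n. c n * z ^ n)"
  shows "(\<lambda>z. \<Sum>n. c n * z ^ n) holomorphic_on UNIV"
    and "(deriv ^^ n) (\<lambda>z. \<Sum>n. c n * z ^ n) 0 = c n * fact n"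
proof -
  have r: "fps_conv_radius (Abs_fps c) = \<infinity>"
    unfolding fps_conv_radius_def
  proof (rule conv_radius_inftyI')
    fix r :: real assume "r > 0"
    thus "\<exists>z. norm z = r \<and> summable (\<lambda>n. fps_nth (Abs_fps c) n * z ^ n)"
      using assms[of "of_real r"] by (intro exI[of _ "of_real r"]) auto
  qed
  have eq: "(\<lambda>z. \<Sum>n. c n * z ^ n) = eval_fps (Abs_fps c)"
    by (simp add: eval_fps_def fun_eq_iff)
  show "(\<lambda>z. \<Sum>n. c n * z ^ n) holomorphic_on UNIV"
    unfolding eq by (rule holomorphic_on_eval_fps) (simp add: r)
  show "(deriv ^^ n) (\<lambda>z. \<Sum>n. c n * z ^ n) 0 = c n * fact n"
    using fps_nth_conv_deriv[of "Abs_fps c" n] r unfolding eq by simp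
qed

text \<open>Each factor z + r with nonzero \<open>r\<close> is a multiple of 1 + z/r.
  \<open>B\<close> lists the numbers 1/r in decreasing order, padded by zeros; comparing the two
  lowest coefficients gives their sum.\<close>

lemma nonneg_hyperbolic_product_form:
  assumes p: "nonneg_hyperbolic p" and l: "coeff p l > 0" "\<And>j. j < l \<Longrightarrow> coeff p j = 0"
  shows "\<exists>B d. antimono B \<and> (\<forall>j. B j \<ge> 0) \<and> (\<forall>j\<ge>d. B j = 0) \<and>
     B sums (coeff p (Suc l) / coeff p l) \<and>
     (\<forall>x. poly p x = coeff p l * x ^ l * (\<Prod>j<d. 1 + B j * x))"
proof -
  obtain rs where rs: "p = smult (lead_coeff p) (\<Prod>r\<leftarrow>rs. [:r, 1:])"
    "\<And>r. r \<in> set rs \<Longrightarrow> r \<ge> 0" "lead_coeff p > 0"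
    using nonneg_hyperbolic_factorization[OF p] by blast
  define bs where "bs = rev (sort (map inverse (filter (\<lambda>r. r \<noteq> 0) rs)))"
  have bs_pos: "b \<ge> 0" if "b \<in> set bs" for b
    using that rs(2) by (auto simp: bs_def)
  define d B where "d = length bs" and "B = (\<lambda>j. if j < d then bs ! j else 0)"
  define q where "q = (\<Prod>j<d. [:1, B j:])"
  \<comment> \<open>\<open>m\<close> counts the factors with \<open>r = 0\<close>, and
    \<open>k\<close> collects the product of the other \<open>r\<close>.\<close>
  have split: "\<exists>k m. (\<Prod>r\<leftarrow>rs. [:r, 1:]) =
      smult k (monom 1 m * (\<Prod>b\<leftarrow>map inverse (filter (\<lambda>r. r \<noteq> 0) rs). [:1, b:]))"
  proof (induction rs)
    case Nil
    show ?case by (intro exI[of _ 1] exI[of _ 0]) simp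
  next
    case (Cons r rs)
    then obtain k m where km: "(\<Prod>r\<leftarrow>rs. [:r, 1:]) =
      smult k (monom 1 m * (\<Prod>b\<leftarrow>map inverse (filter (\<lambda>r. r \<noteq> 0) rs). [:1, b:]))" by blast
    show ?case
    proof (cases "r = 0")
      case True
      thus ?thesis using km
        by (intro exI[of _ k] exI[of _ "Suc m"]) (simp add: monom_Suc)
    next
      case False
      hence "[:r, 1:] = smult r [:1, inverse r:]" by simp
      thus ?thesis using km False
        by (intro exI[of _ "r * k"] exI[of _ m])
           (simp add: mult_ac del: mult_pCons_left mult_pCons_right smult_pCons)
    qed
  qed
  have "(\<Prod>b\<leftarrow>map inverse (filter (\<lambda>r. r \<noteq> 0) rs). [:1, b:]) = (\<Prod>b\<leftarrow>bs. [:1, b:])"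
    unfolding bs_def
    by (simp add: prod_mset_prod_list[symmetric] multiset.map_comp)
  also have "\<dots> = q"
    by (simp add: prod.list_conv_set_nth q_def d_def B_def atLeast0LessThan)
  finally obtain k m where "p = smult k (monom 1 m * q)"
    using split rs(1) by (metis smult_smult)
  hence pc: "coeff p n = (if n < m then 0 else k * coeff q (n - m))" for n
    by (simp add: coeff_monom_mult)
  have q01: "coeff q 0 = 1 \<and> coeff q (Suc 0) = (\<Sum>j<d. B j)"
    unfolding q_def by (induction d) (simp_all add: mult.commute[of _ "[:_, _:]"] coeff_pCons)
  \<comment> \<open>The lowest nonzero coefficient of \<open>p\<close> sits at \<open>m\<close>, as
    \<open>q\<close> has constant term \<open>1\<close>.\<close>
  have "m = l"
  proof (rule ccontr)
    assume "m \<noteq> l"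
    moreover have "\<not> l < m" using l(1) pc[of l] by auto
    ultimately have "k = 0" using l(2)[of m] pc[of m] q01 by simp
    thus False using l(1) pc[of l] by (auto split: if_splits)
  qed
  have k: "k = coeff p l" using pc[of l] q01 \<open>m = l\<close> by simp
  have "coeff p (Suc l) = k * (\<Sum>j<d. B j)" using pc[of "Suc l"] q01 \<open>m = l\<close> by simp
  hence e: "coeff p (Suc l) / coeff p l = (\<Sum>j<d. B j)" using k l(1) by simp
  have B0: "B j \<ge> 0" for j using bs_pos by (auto simp: B_def d_def)
  have "B sums (\<Sum>j<d. B j)" by (rule sums_finite) (auto simp: B_def)
  moreover have "antimono B"
  proof (rule antimonoI)
    fix i j :: nat assume "i \<le> j"
    thus "B j \<le> B i"
      using B0[of i] sorted_rev_nth_mono[of bs i j] by (auto simp: B_def d_def bs_def)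
  qed
  moreover have "poly (smult k (monom 1 m * q)) x = k * x ^ m * (\<Prod>j<d. 1 + B j * x)" for x
    by (simp add: poly_monom q_def poly_prod mult_ac)
  hence "poly p x = coeff p l * x ^ l * (\<Prod>j<d. 1 + B j * x)" for x
    by (metis \<open>p = smult k (monom 1 m * q)\<close> k \<open>m = l\<close>)
  ultimately show ?thesis using e B0
    by (intro exI[of _ B] exI[of _ d]) (auto simp: B_def)
qed

text \<open>The lower bound comes from ln t \<le> t - 1 at t = 1/(1 + y). The quadratic size makes
  the corrections to the linear part of the logarithms summable uniformly in the limit argument
  below.\<close>

lemma abs_ln_one_plus_minus_self_le:
  fixes y :: real
  assumes "y \<ge> 0"
  shows "\<bar>ln (1 + y) - y\<bar> \<le> y\<^sup>2"
proof -
  have "ln (1 / (1 + y)) \<le> 1 / (1 + y) - 1" using assms by (intro ln_le_minus_one) auto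
  hence "ln (1 + y) \<ge> 1 - 1 / (1 + y)" using assms by (simp add: ln_div)
  moreover have "y - (1 - 1 / (1 + y)) = y\<^sup>2 / (1 + y)"
    using assms by (simp add: field_simps power2_eq_square)
  moreover have "y\<^sup>2 / (1 + y) \<le> y\<^sup>2"
    using assms by (simp add: divide_le_eq mult_le_cancel_left1)
  moreover have "ln (1 + y) \<le> y" using assms ln_add_one_self_le_self by simp
  ultimately show ?thesis by simp
qed

text \<open>The reciprocals \<open>B N j\<close> have sum \<open>e N\<close>, which tends to
  \<open>s\<close>, but their limits \<open>\<beta> j\<close> may have a smaller sum. Hence
  \<open>ln (1 + b * x)\<close> is split into \<open>b * x\<close> and a quadratic correction
  \<open>g b\<close>: the linear parts sum exactly to \<open>e N * x\<close>, and the corrections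
  admit dominated convergence. The identity found on the positive axis extends by analytic
  continuation.\<close>

lemma dominated_limit_in_Lplus:
  assumes dom: "dominated_approx p F" and hyp: "\<And>N. p N = 0 \<or> nonneg_hyperbolic (p N)"
    and "F \<noteq> 0" and summ: "\<And>x. x > 0 \<Longrightarrow> summable (\<lambda>n. F $ n * x ^ n)"
  shows "(\<lambda>z. \<Sum>n. complex_of_real (F $ n) * z ^ n) \<in> Lplus"
proof -
  have F_nn: "F $ n \<ge> 0" for n
    using dom unfolding dominated_approx_def by (meson order_trans)
  define l where "l = subdegree F"
  have Fl: "F $ l > 0" using nth_subdegree_nonzero[OF \<open>F \<noteq> 0\<close>] F_nn[of l]
    by (simp add: l_def order_less_le)
  have "eventually (\<lambda>N. coeff (p N) l > 0) sequentially"
    using dom Fl unfolding dominated_approx_def by (auto intro: order_tendstoD(1))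
  then obtain N0 where N0: "\<And>N. N \<ge> N0 \<Longrightarrow> coeff (p N) l > 0"
    by (auto simp: eventually_sequentially)
  \<comment> \<open>Early approximants may have a vanishing coefficient at \<open>l\<close>;
    dropping them makes the quotients \<open>e N\<close> meaningful.\<close>
  define P where "P = (\<lambda>N. p (N + N0))"
  have P_le: "0 \<le> coeff (P N) k" "coeff (P N) k \<le> F $ k" for N k
    using dom by (auto simp: P_def dominated_approx_def)
  have P_lim: "(\<lambda>N. coeff (P N) k) \<longlonglongrightarrow> F $ k" for k
    using dom unfolding P_def dominated_approx_def by (auto intro: LIMSEQ_ignore_initial_segment)
  have Pl: "coeff (P N) l > 0" for N by (simp add: P_def N0)
  have P0: "coeff (P N) j = 0" if "j < l" for N j
    using P_le[of N j] that nth_less_subdegree_zero[of j F] by (simp add: l_def)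
  have P_hyp: "nonneg_hyperbolic (P N)" for N
    using hyp[of "N + N0"] Pl[of N] by (auto simp: P_def)
  define e where "e = (\<lambda>N. coeff (P N) (Suc l) / coeff (P N) l)"
  have "\<forall>N. \<exists>B d. antimono B \<and> (\<forall>j. B j \<ge> 0) \<and> (\<forall>j\<ge>d. B j = 0) \<and> B sums e N \<and>
     (\<forall>x. poly (P N) x = coeff (P N) l * x ^ l * (\<Prod>j<d. 1 + B j * x))"
    using nonneg_hyperbolic_product_form[OF P_hyp Pl P0] unfolding e_def by blast
  then obtain B d where B: "\<And>N. antimono (B N)" "\<And>N j. B N j \<ge> 0" "\<And>N j. j \<ge> d N \<Longrightarrow> B N j = 0"
     "\<And>N. B N sums e N"
     "\<And>N x. poly (P N) x = coeff (P N) l * x ^ l * (\<Prod>j<d N. 1 + B N j * x)"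
    by metis
  define s where "s = F $ Suc l / F $ l"
  have e_lim: "e \<longlonglongrightarrow> s"
    unfolding e_def s_def using Fl by (intro tendsto_intros P_lim) auto
  then obtain M where M: "\<And>N. \<bar>e N\<bar> \<le> M"
    using convergent_imp_Bseq[of e] unfolding convergent_def Bseq_def by auto
  have B_sum: "(\<Sum>i<n. B N i) \<le> e N" for N n
    using B(2,4) sum_le_suminf[of "B N" "{..<n}"] by (simp add: sums_iff)
  \<comment> \<open>A decreasing nonnegative sequence with sum at most \<open>M\<close> decays at
    least this fast, uniformly in \<open>N\<close>.\<close>
  have B_le: "B N j \<le> M / real (Suc j)" for N j
  proof -
    have "real (Suc j) * B N j = (\<Sum>i<Suc j. B N j)" by simp
    also have "\<dots> \<le> (\<Sum>i<Suc j. B N i)"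
      by (intro sum_mono antimonoD[OF B(1)]) auto
    also have "\<dots> \<le> M" using B_sum[of N "Suc j"] M[of N] by linarith
    finally show ?thesis by (simp add: field_simps)
  qed
  have "M \<ge> 0" using M[of 0] by linarith
  have Bn: "norm (B N j) \<le> M" for N j
  proof -
    have "M / real (Suc j) \<le> M / 1" using \<open>M \<ge> 0\<close> by (intro divide_left_mono) auto
    thus ?thesis using B_le[of N j] B(2)[of N j] by simp
  qed
  \<comment> \<open>A diagonal subsequence along which \<open>B N j\<close> converges for every
    fixed \<open>j\<close>.\<close>
  obtain k where k: "strict_mono (k :: nat \<Rightarrow> nat)" "\<And>j. \<exists>b. (\<lambda>n. B (k n) j) \<longlonglongrightarrow> b"
    by (rule function_convergent_subsequence[of UNIV B M]) (use Bn in auto)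
  then obtain \<beta> where \<beta>: "\<And>j. (\<lambda>n. B (k n) j) \<longlonglongrightarrow> \<beta> j" by metis
  have \<beta>0: "\<beta> j \<ge> 0" for j
    using \<beta>[of j] by (rule LIMSEQ_le_const) (use B(2) in auto)
  have \<beta>dec: "\<beta> (Suc j) \<le> \<beta> j" for j
    by (rule LIMSEQ_le[OF \<beta> \<beta>]) (use antimonoD[OF B(1), of j "Suc j"] in auto)
  have e_lim': "(\<lambda>n. e (k n)) \<longlonglongrightarrow> s"
    using LIMSEQ_subseq_LIMSEQ[OF e_lim k(1)] by (simp add: o_def)
  have \<beta>sum: "(\<Sum>i<n. \<beta> i) \<le> s" for n
    by (rule LIMSEQ_le[OF tendsto_sum[OF \<beta>] e_lim']) (use B_sum in auto)
  have \<beta>summ: "summable \<beta>" using \<beta>0 \<beta>sum by (rule summableI_nonneg_bounded)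
  \<comment> \<open>The mass lost in the limit; it becomes the exponential factor.\<close>
  define \<alpha> where "\<alpha> = s - suminf \<beta>"
  have \<alpha>: "\<alpha> \<ge> 0" using suminf_le_const[OF \<beta>summ \<beta>sum] by (simp add: \<alpha>_def)
  define H where "H = (\<lambda>z. \<Sum>n. complex_of_real (F $ n) * z ^ n)"
  define Q where "Q = (\<lambda>z. complex_of_real (F $ l) * z ^ l * exp (complex_of_real \<alpha> * z) *
                 (\<Prod>j. 1 + complex_of_real (\<beta> j) * z))"
  have real_case: "H (of_real x) = Q (of_real x)" if x: "x > 0" for x :: real
  proof -
    define g where "g = (\<lambda>b. ln (1 + b * x) - b * x)"
    have pos: "1 + b * x > 0" if "b \<ge> 0" for b using x that by (simp add: add_pos_nonneg)
    \<comment> \<open>Exact for every \<open>N\<close>, since the \<open>B N j\<close> sum to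
      \<open>e N\<close>.\<close>
    have polyP: "poly (P N) x = coeff (P N) l * x ^ l * exp (e N * x + (\<Sum>j. g (B N j)))" for N
    proof -
      have "(\<Sum>j. g (B N j)) = (\<Sum>j<d N. g (B N j))"
        by (rule suminf_finite) (auto simp: B(3) g_def)
      also have "\<dots> = (\<Sum>j<d N. ln (1 + B N j * x)) - (\<Sum>j<d N. B N j) * x"
        by (simp add: g_def sum_subtractf sum_distrib_right)
      also have "(\<Sum>j<d N. B N j) = e N"
        using B(3)[of N] by (intro sums_unique2[OF sums_finite B(4)]) auto
      finally have "exp (e N * x + (\<Sum>j. g (B N j))) = (\<Prod>j<d N. 1 + B N j * x)"
        using pos[OF B(2)] by (simp add: exp_sum)
      thus ?thesis using B(5) by simp
    qed
    \<comment> \<open>Squaring the decay of \<open>B N j\<close> gives a summable majorant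
      independent of \<open>N\<close>.\<close>
    have g_le: "\<bar>g (B N j)\<bar> \<le> (M * x)\<^sup>2 * (1 / real (Suc j) ^ 2)" for N j
    proof -
      have "\<bar>g (B N j)\<bar> \<le> (B N j * x)\<^sup>2"
        unfolding g_def using B(2) x by (intro abs_ln_one_plus_minus_self_le) auto
      also have "\<dots> \<le> (M / real (Suc j) * x)\<^sup>2"
        using B(2) B_le x by (intro power_mono mult_right_mono) auto
      finally show ?thesis by (simp add: power_mult_distrib power_divide)
    qed
    have g_lim: "(\<lambda>n. g (B (k n) j)) \<longlonglongrightarrow> g (\<beta> j)" for j
      unfolding g_def using pos[OF \<beta>0, of j] by (intro tendsto_intros \<beta>) auto
    have "summable (\<lambda>j. (M * x)\<^sup>2 * (1 / real (Suc j) ^ 2))"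
      using inverse_power_summable[of 2, where 'a = real]
      by (intro summable_mult) (subst summable_Suc_iff, simp add: inverse_eq_divide)
    hence tan: "summable (\<lambda>j. norm (g (\<beta> j))) \<and> (\<lambda>n. \<Sum>j. g (B (k n) j)) \<longlonglongrightarrow> (\<Sum>j. g (\<beta> j))"
      using tannerys_theorem[of "\<lambda>j n. g (B (k n) j)" "\<lambda>j. g (\<beta> j)" sequentially
        "\<lambda>j. (M * x)\<^sup>2 * (1 / real (Suc j) ^ 2)"] g_le g_lim
      by (simp add: case_prod_unfold)
    have lim1: "(\<lambda>n. poly (P (k n)) x) \<longlonglongrightarrow> F $ l * x ^ l * exp (s * x + (\<Sum>j. g (\<beta> j)))"
      unfolding polyP using tan
      by (intro tendsto_intros e_lim' LIMSEQ_subseq_LIMSEQ[OF P_lim k(1), unfolded o_def]) auto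
    \<comment> \<open>Second evaluation of the same limit, with the terms
      \<open>F $ i * x ^ i\<close> as majorant.\<close>
    have "(\<lambda>n. \<Sum>i. coeff (P (k n)) i * x ^ i) \<longlonglongrightarrow> (\<Sum>i. F $ i * x ^ i)"
      using tannerys_theorem[of "\<lambda>i n. coeff (P (k n)) i * x ^ i" "\<lambda>i. F $ i * x ^ i" sequentially
        "\<lambda>i. F $ i * x ^ i"] P_le x summ[OF x]
      by (auto simp: case_prod_unfold abs_mult
          intro!: tendsto_intros LIMSEQ_subseq_LIMSEQ[OF P_lim k(1), unfolded o_def] mult_right_mono)
    moreover have "(\<Sum>i. coeff (P (k n)) i * x ^ i) = poly (P (k n)) x" for n
      unfolding poly_altdef by (rule suminf_finite) (auto simp: coeff_eq_0)
    ultimately have "(\<lambda>n. poly (P (k n)) x) \<longlonglongrightarrow> (\<Sum>i. F $ i * x ^ i)" by simp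
    hence eq1: "(\<Sum>i. F $ i * x ^ i) = F $ l * x ^ l * exp (s * x + (\<Sum>j. g (\<beta> j)))"
      using lim1 LIMSEQ_unique by blast
    have sg: "summable (\<lambda>j. g (\<beta> j))" by (rule summable_norm_cancel) (use tan in simp)
    have sb: "summable (\<lambda>j. \<beta> j * x)" using \<beta>summ by (rule summable_mult2)
    have sl: "summable (\<lambda>j. ln (1 + \<beta> j * x))"
      using summable_add[OF sg sb] by (simp add: g_def)
    \<comment> \<open>Moving \<open>suminf \<beta> * x\<close> back into the logarithms leaves
      exactly \<open>\<alpha> * x\<close> of the linear part.\<close>
    have "(\<Sum>j. ln (1 + \<beta> j * x)) = (\<Sum>j. g (\<beta> j)) + suminf \<beta> * x"
      using suminf_add[OF sg sb] suminf_mult2[OF \<beta>summ, of x] by (simp add: g_def)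
    hence eq2: "s * x + (\<Sum>j. g (\<beta> j)) = \<alpha> * x + (\<Sum>j. ln (1 + \<beta> j * x))"
      by (simp add: \<alpha>_def algebra_simps)
    have "(\<lambda>n. exp (\<Sum>j<n. ln (1 + \<beta> j * x))) \<longlonglongrightarrow> exp (\<Sum>j. ln (1 + \<beta> j * x))"
      using summable_LIMSEQ[OF sl] by (intro tendsto_intros)
    moreover have "exp (\<Sum>j<n. ln (1 + \<beta> j * x)) = (\<Prod>j<n. 1 + \<beta> j * x)" for n
      using pos[OF \<beta>0] by (simp add: exp_sum)
    ultimately have "(\<lambda>n. complex_of_real (\<Prod>j<n. 1 + \<beta> j * x)) \<longlonglongrightarrow>
        of_real (exp (\<Sum>j. ln (1 + \<beta> j * x)))"
      by (simp only: tendsto_of_real_iff)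
    hence "(\<lambda>n. \<Prod>j<n. 1 + complex_of_real (\<beta> j) * of_real x) \<longlonglongrightarrow>
        of_real (exp (\<Sum>j. ln (1 + \<beta> j * x)))" by simp
    moreover have "(\<lambda>n. \<Prod>j<n. 1 + complex_of_real (\<beta> j) * of_real x) \<longlonglongrightarrow>
        (\<Prod>j. 1 + complex_of_real (\<beta> j) * of_real x)"
      using tendsto_uniform_limitI[OF uniform_limit_prod_linear_factors[OF \<beta>summ \<beta>0, of "x"],
          of "of_real x"] x by simp
    ultimately have eq3: "(\<Prod>j. 1 + complex_of_real (\<beta> j) * of_real x) =
        of_real (exp (\<Sum>j. ln (1 + \<beta> j * x)))"
      by (metis LIMSEQ_unique)
    have "H (of_real x) = of_real (\<Sum>i. F $ i * x ^ i)"
      unfolding H_def using summ[OF x] by (subst suminf_of_real) simp_all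
    also have "\<dots> = Q (of_real x)"
      unfolding eq1 eq2 Q_def eq3 by (simp add: exp_add flip: exp_of_real)
    finally show ?thesis .
  qed
  have "summable (\<lambda>n. complex_of_real (F $ n) * z ^ n)" for z
  proof (rule summable_comparison_test')
    show "summable (\<lambda>n. F $ n * (norm z + 1) ^ n)" by (rule summ) (simp add: add_nonneg_pos)
    show "norm (complex_of_real (F $ n) * z ^ n) \<le> F $ n * (norm z + 1) ^ n" for n
      using F_nn by (auto simp: norm_mult norm_power intro!: mult_left_mono power_mono)
  qed
  hence holH: "H holomorphic_on UNIV" unfolding H_def by (rule entire_power_series(1))
  have holQ: "Q holomorphic_on UNIV"
    unfolding Q_def using holomorphic_prod_linear_factors[OF \<beta>summ \<beta>0] by (intro holomorphic_intros)
  have "H z - Q z = 0" for z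
  \<comment> \<open>Agreement on the positive axis suffices, since its points accumulate at
    \<open>0\<close>.\<close>
  proof (rule analytic_continuation[of "\<lambda>z. H z - Q z" UNIV "of_real ` {0<..}" 0])
    show "(0 :: complex) islimpt of_real ` {0<..}"
      unfolding islimpt_approachable
    proof (intro allI impI)
      fix \<epsilon> :: real assume "\<epsilon> > 0"
      thus "\<exists>x'\<in>complex_of_real ` {0<..}. x' \<noteq> 0 \<and> dist x' 0 < \<epsilon>"
        by (intro bexI[of _ "of_real (\<epsilon> / 2)"] imageI) (simp_all add: norm_divide)
    qed
  qed (use holH holQ real_case in \<open>auto intro!: holomorphic_intros\<close>)
  hence "H z = Q z" for z by simp
  thus ?thesis unfolding H_def[symmetric] Lplus_def mem_Collect_eq Q_def
    using \<alpha> \<beta>0 \<beta>dec \<beta>summ by blast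
qed

subsection \<open>The power series of the operator image\<close>

abbreviation derivs0 :: "(complex \<Rightarrow> complex) \<Rightarrow> nat \<Rightarrow> complex" where
  "derivs0 f k \<equiv> (deriv ^^ k) f 0"

text \<open>The constant \<open>c\<close> allows iteration; for \<open>n = 0\<close> the coefficient
  vanishes, so the truncated exponent \<open>n - 1\<close> does no harm.\<close>

lemma Delta_monom:
  "Delta \<theta> (\<lambda>z. c * z ^ n) = (\<lambda>z. c * of_real (of_nat n * (\<theta> + of_nat n - 1)) * z ^ (n - 1))"
proof -
  have d: "deriv (\<lambda>z. c * z ^ n) = (\<lambda>z. c * of_nat n * z ^ (n - 1))" for c :: complex and n
    by (rule ext, rule DERIV_imp_deriv) (auto intro!: derivative_eq_intros)
  have "Delta \<theta> (\<lambda>z. c * z ^ n) = (\<lambda>z. of_real \<theta> * (c * of_nat n * z ^ (n - 1)) +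
      z * (c * of_nat n * of_nat (n - 1) * z ^ (n - 1 - 1)))"
    by (simp only: Delta_def d)
  moreover have "n = 0 \<or> n = 1 \<or> (\<exists>m. n = Suc (Suc m))" by (metis One_nat_def not0_implies_Suc)
  ultimately show ?thesis by (auto simp: fun_eq_iff algebra_simps)
qed

lemma Delta_funpow_monom:
  "(Delta \<theta> ^^ k) (\<lambda>z. z ^ m) = (\<lambda>z. if k \<le> m
     then of_real (fact m / fact (m - k) * pochhammer (\<theta> + of_nat (m - k)) k) * z ^ (m - k) else 0)"
proof (induction k)
  case (Suc k)
  show ?case
  proof (cases "Suc k \<le> m")
    case True
    then obtain j where j: "m - k = Suc j" "m - Suc k = j" by (metis Suc_diff_Suc Suc_le_lessD)
    have "(Delta \<theta> ^^ Suc k) (\<lambda>z. z ^ m) =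
      Delta \<theta> (\<lambda>z. of_real (fact m / fact (Suc j) * pochhammer (\<theta> + of_nat (Suc j)) k) * z ^ Suc j)"
      using Suc True j by simp
    also have "\<dots> = (\<lambda>z. of_real (fact m / fact (Suc j) * pochhammer (\<theta> + of_nat (Suc j)) k *
        (of_nat (Suc j) * (\<theta> + of_nat j))) * z ^ j)"
    proof -
      have "\<theta> + of_nat (Suc j) - 1 = \<theta> + of_nat j" by simp
      thus ?thesis by (simp only: Delta_monom of_real_mult diff_Suc_1)
    qed
    also have "fact m / fact (Suc j) * pochhammer (\<theta> + of_nat (Suc j)) k * (of_nat (Suc j) * (\<theta> + of_nat j))
      = fact m / fact j * pochhammer (\<theta> + of_nat j) (Suc k)"
    proof -
      have "\<theta> + of_nat (Suc j) = \<theta> + of_nat j + 1" by simp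
      moreover have "fact m / fact (Suc j) * P * (of_nat (Suc j) * t) = fact m / fact j * (t * P)" for P t :: real
        by (simp del: of_nat_Suc)
      ultimately show ?thesis unfolding pochhammer_rec by metis
    qed
    finally show ?thesis using True j by simp
  next
    case False
    \<comment> \<open>Here \<open>m \<le> k\<close>, so this power yields a constant, possibly
      \<open>0\<close>; writing it with \<open>z ^ 0\<close> lets \<open>Delta_monom\<close>
      annihilate it.\<close>
    have "(Delta \<theta> ^^ k) (\<lambda>z. z ^ m) = (\<lambda>z. (if k \<le> m
      then of_real (fact m / fact (m - k) * pochhammer (\<theta> + of_nat (m - k)) k) else 0) * z ^ 0)"
      using Suc False by (auto simp: fun_eq_iff)
    hence "(Delta \<theta> ^^ Suc k) (\<lambda>z. z ^ m) = (\<lambda>_. 0)"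
      by (simp only: funpow.simps o_apply Delta_monom) simp
    thus ?thesis using False by simp
  qed
qed simp

text \<open>Binomial series with exponent \<open>- t\<close>; the signs of the generalized binomial
  coefficients and of \<open>(- x) ^ k\<close> cancel.\<close>

lemma pochhammer_binomial_series:
  fixes x t :: real
  assumes "0 \<le> x" "x < 1"
  shows "(\<lambda>k. x ^ k * (pochhammer t k / fact k)) sums (1 - x) powr (- t)"
proof -
  have "(- t gchoose k) * (- x) ^ k = x ^ k * (pochhammer t k / fact k)" for k
    by (simp add: gbinomial_pochhammer power_minus[of x])
  thus ?thesis using gen_binomial_real[of "- x" "- t"] assms by simp
qed

text \<open>Fubini for summable families: \<open>op_apply\<close> sums over \<open>k\<close> on the
  outside, whereas its power series needs \<open>k\<close> on the inside.\<close>

lemma suminf_swap: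
  fixes f :: "nat \<Rightarrow> nat \<Rightarrow> complex"
  assumes "(\<lambda>(k, n). f k n) summable_on UNIV"
  shows "(\<Sum>k. \<Sum>n. f k n) = (\<Sum>n. \<Sum>k. f k n)"
    and "summable (f k)" and "summable (\<lambda>n. \<Sum>k. f k n)"
proof -
  have s: "suminf g = infsum g UNIV" if "g summable_on UNIV" for g :: "nat \<Rightarrow> complex"
    using has_sum_imp_sums[OF has_sum_infsum[OF that]] by (simp add: sums_iff)
  have 1: "(\<lambda>(k, n). f k n) summable_on UNIV \<times> UNIV" using assms by simp
  have 2: "(\<lambda>(n, k). f k n) summable_on UNIV \<times> UNIV"
    using 1 by (subst summable_on_swap) (simp add: case_prod_unfold)
  have s1: "f k summable_on UNIV" for k using summable_on_SigmaD1[OF 1] by simp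
  have s2: "(\<lambda>k. f k n) summable_on UNIV" for n
    using summable_on_SigmaD1[of "\<lambda>n k. f k n", OF 2] by simp
  have s3: "(\<lambda>k. infsum (f k) UNIV) summable_on UNIV" using summable_on_Sigma_banach[OF 1] .
  have s4: "(\<lambda>n. infsum (\<lambda>k. f k n) UNIV) summable_on UNIV"
    using summable_on_Sigma_banach[of "\<lambda>n k. f k n", OF 2] .
  show "(\<Sum>k. \<Sum>n. f k n) = (\<Sum>n. \<Sum>k. f k n)"
    using infsum_swap_banach[OF 1] by (simp add: s s1 s2 s3 s4)
  show "summable (f k)" using s1 by (rule summable_on_imp_summable)
  show "summable (\<lambda>n. \<Sum>k. f k n)"
    using summable_on_imp_summable[OF s4] by (simp add: s s2)
qed

text \<open>Contribution of the \<open>k\<close>-th derivative of \<phi> to the \<open>n\<close>-th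
  derivative of the image at \<open>0\<close>. Arbitrary sequences are allowed so that bilinearity
  can be used for differences.\<close>

definition op_term :: "real \<Rightarrow> (nat \<Rightarrow> complex) \<Rightarrow> (nat \<Rightarrow> complex) \<Rightarrow> nat \<Rightarrow> nat \<Rightarrow> complex" where
  "op_term \<theta> u v n k = u k * v (n + k) * of_real (pochhammer (\<theta> + of_nat n) k / fact k)"

definition op_coeff :: "real \<Rightarrow> (nat \<Rightarrow> complex) \<Rightarrow> (nat \<Rightarrow> complex) \<Rightarrow> nat \<Rightarrow> complex" where
  "op_coeff \<theta> u v n = (\<Sum>k. op_term \<theta> u v n k)"

text \<open>Summing over \<open>k\<close> by the binomial series gives \<open>1 - a * b\<close> to
  the power \<open>- \<theta> - n\<close>; the part with exponent \<open>- n\<close> joins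
  \<open>b ^ n\<close> and produces the radius \<open>b / (1 - a * b)\<close>.\<close>

lemma op_term_bound:
  fixes a b U V \<theta> :: real
  assumes "\<theta> \<ge> 0" "a \<ge> 0" "b \<ge> 0" "a * b < 1"
    and u: "\<And>k. norm (u k) \<le> U * a ^ k" and v: "\<And>k. norm (v k) \<le> V * b ^ k"
  shows "norm (op_term \<theta> u v n k) \<le>
      U * V * b ^ n * ((a * b) ^ k * (pochhammer (\<theta> + of_nat n) k / fact k))"
    and "(\<lambda>k. U * V * b ^ n * ((a * b) ^ k * (pochhammer (\<theta> + of_nat n) k / fact k))) sums
      (U * V * (1 - a * b) powr (- \<theta>) * (b / (1 - a * b)) ^ n)"
    and "summable (\<lambda>k. norm (op_term \<theta> u v n k))"
    and "norm (op_coeff \<theta> u v n) \<le> U * V * (1 - a * b) powr (- \<theta>) * (b / (1 - a * b)) ^ n"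
proof -
  have p: "pochhammer (\<theta> + of_nat n) k \<ge> 0" for k
    using assms(1) by (simp add: pochhammer_prod prod_nonneg)
  show 1: "norm (op_term \<theta> u v n k) \<le>
      U * V * b ^ n * ((a * b) ^ k * (pochhammer (\<theta> + of_nat n) k / fact k))" for k
  proof -
    have "norm (op_term \<theta> u v n k) =
        norm (u k) * norm (v (n + k)) * (pochhammer (\<theta> + of_nat n) k / fact k)"
      using p[of k] by (simp add: op_term_def norm_mult norm_divide)
    also have "\<dots> \<le> (U * a ^ k) * (V * b ^ (n + k)) * (pochhammer (\<theta> + of_nat n) k / fact k)"
      using p[of k] by (intro mult_right_mono mult_mono u v order_trans[OF norm_ge_zero u]) auto
    finally show ?thesis by (simp add: power_add power_mult_distrib mult_ac)
  qed
  have pw: "(1 - a * b) powr (- (\<theta> + of_nat n)) = (1 - a * b) powr (- \<theta>) / (1 - a * b) ^ n"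
    using assms(4) by (simp add: powr_diff powr_realpow)
  have "(\<lambda>k. U * V * b ^ n * ((a * b) ^ k * (pochhammer (\<theta> + of_nat n) k / fact k))) sums
      (U * V * b ^ n * (1 - a * b) powr (- (\<theta> + of_nat n)))"
    using assms by (intro sums_mult pochhammer_binomial_series) auto
  thus 2: "(\<lambda>k. U * V * b ^ n * ((a * b) ^ k * (pochhammer (\<theta> + of_nat n) k / fact k))) sums
      (U * V * (1 - a * b) powr (- \<theta>) * (b / (1 - a * b)) ^ n)"
    unfolding pw by (simp add: power_divide mult_ac)
  show 3: "summable (\<lambda>k. norm (op_term \<theta> u v n k))"
    by (rule summable_comparison_test'[OF sums_summable[OF 2]]) (use 1 in simp)
  have "norm (op_coeff \<theta> u v n) \<le> (\<Sum>k. norm (op_term \<theta> u v n k))"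
    unfolding op_coeff_def by (rule summable_norm[OF 3])
  also have "\<dots> \<le> U * V * (1 - a * b) powr (- \<theta>) * (b / (1 - a * b)) ^ n"
    using suminf_le[OF 1 3 sums_summable[OF 2]] 2 by (simp add: sums_iff)
  finally show "norm (op_coeff \<theta> u v n) \<le> U * V * (1 - a * b) powr (- \<theta>) * (b / (1 - a * b)) ^ n" .
qed

text \<open>The substitution \<open>m = n + k\<close> brings the terms of \<open>op_apply\<close>
  into the form \<open>T\<close>. These are absolutely summable over all pairs, so they can be
  collected by powers of \<open>z\<close>.\<close>

lemma op_apply_expansion:
  fixes a b U V \<theta> :: real
  assumes ab: "\<theta> \<ge> 0" "a \<ge> 0" "b \<ge> 0" "a * b < 1"
    and u: "\<And>k. norm (derivs0 \<phi> k) \<le> U * a ^ k" and v: "\<And>k. norm (derivs0 f k) \<le> V * b ^ k"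
  defines "G \<equiv> op_coeff \<theta> (derivs0 \<phi>) (derivs0 f)"
  shows "op_apply \<theta> \<phi> f = (\<lambda>z. \<Sum>n. G n / fact n * z ^ n)"
    and "summable (\<lambda>n. G n / fact n * z ^ n)"
    and "op_apply \<theta> \<phi> f holomorphic_on UNIV"
    and "derivs0 (op_apply \<theta> \<phi> f) n = G n"
proof -
  define T where "T = (\<lambda>z k n. op_term \<theta> (derivs0 \<phi>) (derivs0 f) n k / fact n * z ^ n)"
  have T_summable: "(\<lambda>(k, n). T z k n) summable_on UNIV" for z
  proof -
    \<comment> \<open>Majorant of \<open>T\<close>: summing over \<open>k\<close> first leaves a
      multiple of the exponential series at \<open>b / (1 - a * b) * norm z\<close>.\<close>
    define h where "h = (\<lambda>(n, k). U * V * b ^ n * ((a * b) ^ k * (pochhammer (\<theta> + of_nat n) k / fact k))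
        * (norm z ^ n / fact n))"
    define K where "K = U * V * (1 - a * b) powr (- \<theta>)"
    have UV: "U \<ge> 0" "V \<ge> 0" 
      using order_trans[OF norm_ge_zero u[of 0]] order_trans[OF norm_ge_zero v[of 0]] by simp_all
    have p: "pochhammer (\<theta> + of_nat n) k \<ge> 0" for n k
      using ab(1) by (simp add: pochhammer_prod prod_nonneg)
    have h_nn: "h (n, k) \<ge> 0" for n k
      using UV ab p[of n k] by (simp add: h_def)
    have "h summable_on UNIV \<times> UNIV"
    proof (rule summable_on_SigmaI)
      show "((\<lambda>k. h (n, k)) has_sum (K * (b / (1 - a * b)) ^ n * (norm z ^ n / fact n))) UNIV" for n
      proof (rule sums_nonneg_imp_has_sum)
        show "(\<lambda>k. h (n, k)) sums (K * (b / (1 - a * b)) ^ n * (norm z ^ n / fact n))"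
          unfolding h_def K_def prod.case by (rule sums_mult2[OF op_term_bound(2)[OF ab u v]])
      qed (rule h_nn)
      define y where "y = b / (1 - a * b) * norm z"
      have "K \<ge> 0" "y \<ge> 0" using UV ab by (simp_all add: K_def y_def)
      moreover have "summable (\<lambda>n. K * (inverse (fact n) * y ^ n))"
        by (intro summable_mult summable_exp)
      ultimately have "(\<lambda>n. K * (inverse (fact n) * y ^ n)) summable_on UNIV"
        by (subst summable_on_UNIV_nonneg_real_iff) simp_all
      thus "(\<lambda>n. K * (b / (1 - a * b)) ^ n * (norm z ^ n / fact n)) summable_on UNIV"
        unfolding y_def by (simp add: power_mult_distrib divide_inverse mult_ac)
    qed (use h_nn in auto)
    moreover have "norm (T z k n) \<le> h (n, k)" for k n
      using mult_right_mono[OF op_term_bound(1)[OF ab u v, of n k], of "norm z ^ n / fact n"]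
      by (simp add: T_def h_def norm_mult norm_divide norm_power)
    ultimately have "(\<lambda>x. norm ((\<lambda>(n, k). T z k n) x)) summable_on UNIV \<times> UNIV"
      by (intro Infinite_Sum.abs_summable_on_comparison_test'[of h]) auto
    hence "(\<lambda>(n, k). T z k n) summable_on UNIV \<times> UNIV" by (rule abs_summable_summable)
    thus ?thesis by (subst (asm) summable_on_swap) (simp add: case_prod_unfold)
  qed
  have GT: "(\<Sum>k. T z k n) = G n / fact n * z ^ n" for z n
  proof -
    have "summable (\<lambda>k. op_term \<theta> (derivs0 \<phi>) (derivs0 f) n k)"
      using op_term_bound(3)[OF ab u v] summable_norm_cancel by blast
    hence "(\<lambda>k. op_term \<theta> (derivs0 \<phi>) (derivs0 f) n k * (z ^ n / fact n)) sums (G n * (z ^ n / fact n))"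
      unfolding G_def op_coeff_def by (intro sums_mult2 summable_sums)
    thus ?thesis by (simp add: T_def sums_iff)
  qed
  show eq: "op_apply \<theta> \<phi> f = (\<lambda>z. \<Sum>n. G n / fact n * z ^ n)"
  proof (rule ext)
    fix z
    define S where "S = (\<lambda>k m. derivs0 \<phi> k / fact k * (derivs0 f m / fact m) * (Delta \<theta> ^^ k) (\<lambda>w. w ^ m) z)"
    have "(\<Sum>m. S k m) = (\<Sum>n. T z k n)" for k
    proof -
      \<comment> \<open>Terms with \<open>m < k\<close> vanish, so the inner sum can be shifted by
        \<open>k\<close>.\<close>
      have ST: "S k (n + k) = T z k n" for n
        by (simp add: S_def T_def Delta_funpow_monom op_term_def field_simps)
      have S0: "S k m = 0" if "m < k" for m using that by (simp add: S_def Delta_funpow_monom)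
      have "summable (\<lambda>n. S k (n + k))" unfolding ST by (rule suminf_swap(2)[OF T_summable])
      hence "summable (S k)" by (simp add: summable_iff_shift)
      from suminf_split_initial_segment[OF this, of k] show ?thesis by (simp add: ST S0)
    qed
    hence "op_apply \<theta> \<phi> f z = (\<Sum>k. \<Sum>n. T z k n)" by (simp add: op_apply_def S_def)
    also have "\<dots> = (\<Sum>n. \<Sum>k. T z k n)" by (rule suminf_swap(1)[OF T_summable])
    finally show "op_apply \<theta> \<phi> f z = (\<Sum>n. G n / fact n * z ^ n)" by (simp add: GT)
  qed
  show summ: "summable (\<lambda>n. G n / fact n * z ^ n)" for z
    using suminf_swap(3)[OF T_summable[of z]] by (simp add: GT)
  show "op_apply \<theta> \<phi> f holomorphic_on UNIV" unfolding eq by (rule entire_power_series(1)[OF summ])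
  show "derivs0 (op_apply \<theta> \<phi> f) n = G n" unfolding eq entire_power_series(2)[OF summ] by simp
qed

section \<open>Membership of the image in \<open>Lplus\<close>\<close>

lemma Lplus_mult_const:
  assumes "f \<in> Lplus"
  shows "(\<lambda>z. K * f z) \<in> Lplus"
proof -
  obtain C l \<alpha> \<beta> where *: "\<alpha> \<ge> 0 \<and> (\<forall>j. \<beta> j \<ge> \<beta> (Suc j)) \<and> (\<forall>j. \<beta> j \<ge> 0) \<and> summable \<beta>"
     and f: "\<forall>z. f z = C * z ^ l * exp (complex_of_real \<alpha> * z) *
                 (\<Prod>j. 1 + complex_of_real (\<beta> j) * z)"
    using assms unfolding Lplus_def by blast
  have "\<forall>z. K * f z = (K * C) * z ^ l * exp (complex_of_real \<alpha> * z) *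
                 (\<Prod>j. 1 + complex_of_real (\<beta> j) * z)"
    using f by (simp add: mult_ac)
  thus ?thesis using * unfolding Lplus_def mem_Collect_eq by blast
qed

lemma zero_in_Lplus: "(\<lambda>_. 0) \<in> Lplus"
proof -
  have "(\<lambda>_. 1) \<in> Lplus"
    unfolding Lplus_def mem_Collect_eq
    by (rule exI[of _ 1], rule exI[of _ 0], rule exI[of _ 0], rule exI[of _ "\<lambda>_. 0"]) simp
  from Lplus_mult_const[OF this, of 0] show ?thesis by simp
qed

text \<open>Tannery's theorem carries the approximations of \<phi> and \<open>f\<close> over to the
  image; \<open>dominated_limit_in_Lplus\<close> then applies to \<open>G\<close>, the image without
  the factor \<open>C * D\<close>.\<close>

lemma op_apply_in_Lplus:
  fixes a b U V \<theta> :: real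
  assumes ab: "\<theta> \<ge> 0" "a \<ge> 0" "b \<ge> 0" "a * b < 1"
    and u: "\<And>k. norm (derivs0 \<phi> k) \<le> U * a ^ k" and v: "\<And>k. norm (derivs0 f k) \<le> V * b ^ k"
    and "\<phi> \<in> Lplus" "f \<in> Lplus"
  shows "op_apply \<theta> \<phi> f \<in> Lplus"
proof (cases "\<phi> = (\<lambda>_. 0) \<or> f = (\<lambda>_. 0)")
  case True
  have d0: "derivs0 (\<lambda>_. 0) k = 0" for k
    by (induction k) (simp_all add: higher_deriv_const)
  have "op_coeff \<theta> (derivs0 \<phi>) (derivs0 f) = (\<lambda>_. 0)"
    using True by (auto simp: op_coeff_def op_term_def d0)
  hence "op_apply \<theta> \<phi> f = (\<lambda>_. 0)"
    using op_apply_expansion(1)[OF ab u v] by simp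
  thus ?thesis by (simp add: zero_in_Lplus)
next
  case False
  obtain C F p where 1: "C \<noteq> 0" "\<And>k. derivs0 \<phi> k / fact k = C * of_real (F $ k)"
    "dominated_approx p F" "\<And>N. nonneg_hyperbolic (p N)"
    using Lplus_dominated_approx[OF assms(7)] False by blast
  obtain D E q where 2: "D \<noteq> 0" "\<And>k. derivs0 f k / fact k = D * of_real (E $ k)"
    "dominated_approx q E" "\<And>N. nonneg_hyperbolic (q N)"
    using Lplus_dominated_approx[OF assms(8)] False by blast
  have F_nn: "F $ k \<ge> 0" and E_nn: "E $ k \<ge> 0" for k
    using 1(3) 2(3) unfolding dominated_approx_def by (meson order_trans)+
  have pq: "0 \<le> coeff (p N) k" "coeff (p N) k \<le> F $ k" "0 \<le> coeff (q N) k" "coeff (q N) k \<le> E $ k"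
    "(\<lambda>N. coeff (p N) k) \<longlonglongrightarrow> F $ k" "(\<lambda>N. coeff (q N) k) \<longlonglongrightarrow> E $ k" for N k
    using 1(3) 2(3) by (auto simp: dominated_approx_def)
  \<comment> \<open>Weight for Taylor coefficients instead of derivatives: the \<open>fact k\<close>
    of \<phi> cancels the one in \<open>op_term\<close>, and the factorials of \<open>f\<close> and
    of the image form the quotient.\<close>
  define w where "w = (\<lambda>n k. (fact (n + k) / fact n) * pochhammer (\<theta> + of_nat n) k)"
  have w_nn: "w n k \<ge> 0" for n k
    using ab(1) by (simp add: w_def pochhammer_prod prod_nonneg)
  define t where "t = (\<lambda>n k. F $ k * E $ (n + k) * w n k)"
  have t_nn: "t n k \<ge> 0" for n k by (simp add: t_def F_nn E_nn w_nn)
  define G where "G = Abs_fps (\<lambda>n. \<Sum>k. t n k)"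
  have term_eq: "op_term \<theta> (derivs0 \<phi>) (derivs0 f) n k = C * D * fact n * of_real (t n k)" for n k
  proof -
    have "derivs0 \<phi> k = C * of_real (F $ k) * fact k" "derivs0 f (n + k) = D * of_real (E $ (n + k)) * fact (n + k)"
      using 1(2)[of k] 2(2)[of "n + k"] by (simp_all add: divide_simps)
    thus ?thesis by (simp add: op_term_def t_def w_def)
  qed
  have t_summ: "summable (t n)" for n
  proof -
    have "summable (\<lambda>k. norm (C * D * fact n) * t n k)"
      using op_term_bound(3)[OF ab u v, of n] t_nn by (simp add: term_eq norm_mult)
    thus ?thesis using 1(1) 2(1) by simp
  qed
  have coeff_eq: "op_coeff \<theta> (derivs0 \<phi>) (derivs0 f) n / fact n = C * D * of_real (G $ n)" for n
  proof -
    have "(\<lambda>k. C * D * fact n * of_real (t n k)) sums (C * D * fact n * of_real (\<Sum>k. t n k))"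
      using t_summ by (intro sums_mult sums_of_real summable_sums)
    thus ?thesis by (simp add: op_coeff_def term_eq G_def sums_iff)
  qed
  have "summable (\<lambda>n. C * D * (complex_of_real (G $ n) * z ^ n))" for z
    using op_apply_expansion(2)[OF ab u v, of z] by (simp add: coeff_eq mult_ac)
  hence G_summ: "summable (\<lambda>n. complex_of_real (G $ n) * z ^ n)" for z
    using 1(1) 2(1) by (simp add: summable_cmult_iff)
  have op_eq: "op_apply \<theta> \<phi> f = (\<lambda>z. C * D * (\<Sum>n. complex_of_real (G $ n) * z ^ n))"
    unfolding op_apply_expansion(1)[OF ab u v] coeff_eq
    using suminf_mult[OF G_summ, of "C * D"] by (simp add: mult.assoc)
  show ?thesis
  \<comment> \<open>The image can vanish for nonzero functions, for instance for \<phi> = z and f =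
    1.\<close>
  proof (cases "G = 0")
    case True
    thus ?thesis unfolding op_eq by (simp add: zero_in_Lplus)
  next
    case False
    have "dominated_approx (\<lambda>N. op_poly \<theta> (p N) (q N)) G"
      unfolding dominated_approx_def
    proof (intro allI conjI)
      fix n
      \<comment> \<open>Domination by the summable \<open>t n\<close> gives both the upper bound and
        the passage to the limit.\<close>
      have le: "coeff (p N) k * coeff (q N) (n + k) * w n k \<le> t n k" for N k
        unfolding t_def by (intro mult_right_mono mult_mono pq w_nn F_nn)
      have nn: "0 \<le> coeff (p N) k * coeff (q N) (n + k) * w n k" for N k
        by (intro mult_nonneg_nonneg pq w_nn)
      have c: "coeff (op_poly \<theta> (p N) (q N)) n = (\<Sum>k. coeff (p N) k * coeff (q N) (n + k) * w n k)" for N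
        by (simp add: coeff_op_poly w_def mult_ac)
      have summ: "summable (\<lambda>k. coeff (p N) k * coeff (q N) (n + k) * w n k)" for N
        by (rule summable_comparison_test'[OF t_summ[of n]]) (use le nn in auto)
      have lim: "(\<lambda>N. coeff (p N) k * coeff (q N) (n + k) * w n k) \<longlonglongrightarrow> t n k" for k
        unfolding t_def by (intro tendsto_intros pq)
      show "0 \<le> coeff (op_poly \<theta> (p N) (q N)) n" for N
        unfolding c using summ nn by (rule suminf_nonneg)
      show "coeff (op_poly \<theta> (p N) (q N)) n \<le> G $ n" for N
        unfolding c G_def using le summ t_summ by (simp add: suminf_le)
      show "(\<lambda>N. coeff (op_poly \<theta> (p N) (q N)) n) \<longlonglongrightarrow> G $ n"
        using tannerys_theorem[of "\<lambda>k N. coeff (p N) k * coeff (q N) (n + k) * w n k" "t n" sequentially "t n"]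
          le nn t_summ[of n] lim
        unfolding c G_def by (simp add: case_prod_unfold)
    qed
    moreover have "op_poly \<theta> (p N) (q N) = 0 \<or> nonneg_hyperbolic (op_poly \<theta> (p N) (q N))" for N
      using nonneg_hyperbolic_op_poly[OF 1(4) 2(4) ab(1)] by blast
    moreover have "summable (\<lambda>n. G $ n * x ^ n)" for x
      using G_summ[of "of_real x"] by (simp flip: of_real_power of_real_mult add: summable_complex_of_real)
    ultimately have "(\<lambda>z. \<Sum>n. complex_of_real (G $ n) * z ^ n) \<in> Lplus"
      using False by (intro dominated_limit_in_Lplus) auto
    thus ?thesis unfolding op_eq by (rule Lplus_mult_const)
  qed
qed

subsection \<open>Continuity\<close>

text \<open>A real supremum bounds its family only if the family is bounded above, which membership
  in \<open>Aspace\<close> guarantees.\<close>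

lemma Aspace_derivs0_le:
  assumes "f \<in> Aspace a" "a' > a" "a \<ge> 0"
  shows "norm (derivs0 f k) \<le> bnorm a' f * a' ^ k"
proof -
  have "norm (derivs0 f k) / a' ^ k \<le> bnorm a' f"
    unfolding bnorm_def using assms by (intro cSUP_upper) (auto simp: Aspace_def)
  thus ?thesis using assms by (simp add: divide_le_eq)
qed

lemma Aspace_bnorm_nonneg:
  assumes "f \<in> Aspace a" "a' > a" "a \<ge> 0"
  shows "bnorm a' f \<ge> 0"
  using order_trans[OF norm_ge_zero Aspace_derivs0_le[OF assms, of 0]] by simp

lemma bnorm_le:
  assumes "\<And>k. norm (derivs0 f k) \<le> K * c ^ k" "c > 0"
  shows "bnorm c f \<le> K"
  unfolding bnorm_def using assms by (intro cSUP_least) (auto simp: divide_le_eq)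

lemma AspaceI:
  assumes "f holomorphic_on UNIV" "a \<ge> 0"
    and "\<And>b. b > a \<Longrightarrow> \<exists>K. \<forall>k. norm (derivs0 f k) \<le> K * b ^ k"
  shows "f \<in> Aspace a"
  unfolding Aspace_def entire_def mem_Collect_eq
proof (intro conjI allI impI assms(1))
  fix b assume b: "b > a"
  then obtain K where "\<And>k. norm (derivs0 f k) \<le> K * b ^ k" using assms(3) by blast
  thus "bdd_above (range (\<lambda>k. norm (derivs0 f k) / b ^ k))"
    using b assms(2) by (intro bdd_aboveI[of _ K]) (auto simp: divide_le_eq)
qed

lemma Aspace_derivs0_diff:
  assumes "f \<in> Aspace a" "g \<in> Aspace a"
  shows "derivs0 (\<lambda>z. f z - g z) k = derivs0 f k - derivs0 g k"
  using assms by (intro higher_deriv_diff[of _ UNIV]) (auto simp: Aspace_def entire_def)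

lemma Aspace_diff:
  assumes "f \<in> Aspace a" "g \<in> Aspace a" "a \<ge> 0"
  shows "(\<lambda>z. f z - g z) \<in> Aspace a"
proof (rule AspaceI)
  show "(\<lambda>z. f z - g z) holomorphic_on UNIV"
    using assms by (auto simp: Aspace_def entire_def intro!: holomorphic_intros)
  fix b assume b: "b > a"
  have "norm (derivs0 (\<lambda>z. f z - g z) k) \<le> (bnorm b f + bnorm b g) * b ^ k" for k
    unfolding Aspace_derivs0_diff[OF assms(1,2)] distrib_right
    by (intro order_trans[OF norm_triangle_ineq4] add_mono Aspace_derivs0_le[OF assms(1) b assms(3)]
        Aspace_derivs0_le[OF assms(2) b assms(3)])
  thus "\<exists>K. \<forall>k. norm (derivs0 (\<lambda>z. f z - g z) k) \<le> K * b ^ k" by blast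
qed (use assms in auto)

lemma bnorm_triangle:
  assumes "f \<in> Aspace a" "g \<in> Aspace a" "h \<in> Aspace a" "b > a" "a \<ge> 0"
  shows "bnorm b (\<lambda>z. f z - h z) \<le> bnorm b (\<lambda>z. f z - g z) + bnorm b (\<lambda>z. g z - h z)"
proof (rule bnorm_le)
  fix k
  have "derivs0 (\<lambda>z. f z - h z) k = derivs0 (\<lambda>z. f z - g z) k + derivs0 (\<lambda>z. g z - h z) k"
    using assms by (simp add: Aspace_derivs0_diff)
  also have "norm \<dots> \<le> bnorm b (\<lambda>z. f z - g z) * b ^ k + bnorm b (\<lambda>z. g z - h z) * b ^ k"
    using assms by (intro order_trans[OF norm_triangle_ineq] add_mono Aspace_derivs0_le Aspace_diff)
  finally show "norm (derivs0 (\<lambda>z. f z - h z) k) \<le> (bnorm b (\<lambda>z. f z - g z) + bnorm b (\<lambda>z. g z - h z)) * b ^ k"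
    by (simp add: distrib_right)
qed (use assms in auto)

lemma bnorm_zero: "bnorm b (\<lambda>_. 0) = 0"
proof -
  have "derivs0 (\<lambda>z. 0) k = 0" for k by (induction k) (simp_all add: higher_deriv_const)
  thus ?thesis by (simp add: bnorm_def)
qed

section \<open>Neighbourhoods in \<open>Atop\<close>\<close>

lemma openin_Atop_ball:
  assumes "f \<in> Aspace a" "b > a" "e > 0"
  shows "openin (Atop a) {g \<in> Aspace a. bnorm b (\<lambda>z. g z - f z) < e}"
  unfolding Atop_def using assms by (intro topology_generated_by_Basis) blast

lemma topspace_Atop: "topspace (Atop a) = Aspace a"
proof
  show "Aspace a \<subseteq> topspace (Atop a)"
  proof
    fix f assume f: "f \<in> Aspace a"
    have "f \<in> {g \<in> Aspace a. bnorm (a + 1) (\<lambda>z. g z - f z) < 1}"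
      using f by (simp add: bnorm_zero)
    thus "f \<in> topspace (Atop a)"
      using openin_subset[OF openin_Atop_ball[OF f, of "a + 1" 1]] by auto
  qed
qed (auto simp: Atop_def topology_generated_by_topspace)

text \<open>Functions in \<open>Aspace a\<close> are controlled only at radii above
  \<open>a\<close>. The strict inequalities depend continuously on the radii, so they survive
  passing to \<open>a + t\<close> and \<open>b + t\<close> for small \<open>t > 0\<close>.\<close>

lemma enlarged_radii:
  fixes a b c' :: real
  assumes "a \<ge> 0" "b \<ge> 0" "a * b < 1" "c' > b / (1 - a * b)"
  obtains a' b' where "a' > a" "b' > b" "a' * b' < 1" "b' / (1 - a' * b') < c'"
proof -
  have "((\<lambda>t. (a + t) * (b + t)) \<longlongrightarrow> (a + 0) * (b + 0)) (at_right 0)"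
    by (intro tendsto_intros)
  hence "eventually (\<lambda>t. (a + t) * (b + t) < 1) (at_right 0)"
    using assms by (intro order_tendstoD(2)) auto
  moreover have "((\<lambda>t. (b + t) / (1 - (a + t) * (b + t))) \<longlongrightarrow> (b + 0) / (1 - (a + 0) * (b + 0))) (at_right 0)"
    using assms by (intro tendsto_intros) auto
  hence "eventually (\<lambda>t. (b + t) / (1 - (a + t) * (b + t)) < c') (at_right 0)"
    using assms by (intro order_tendstoD(2)) auto
  moreover have "eventually (\<lambda>t. t > (0::real)) (at_right 0)" by (rule eventually_at_right_less)
  ultimately have "eventually (\<lambda>t. t > 0 \<and> (a + t) * (b + t) < 1 \<and>
      (b + t) / (1 - (a + t) * (b + t)) < c') (at_right 0)"
    by eventually_elim auto
  then obtain t where "t > 0" "(a + t) * (b + t) < 1" "(b + t) / (1 - (a + t) * (b + t)) < c'"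
    using eventually_happens[of _ "at_right (0::real)"] by (auto simp: trivial_limit_at_right_real)
  thus ?thesis using that[of "a + t" "b + t"] by simp
qed

text \<open>Bounds at radii slightly above \<open>a\<close> and \<open>b\<close> give bounds at
  every radius above \<open>b / (1 - a * b)\<close>.\<close>

lemma op_apply_Aspace:
  fixes a b \<theta> :: real
  assumes "\<theta> \<ge> 0" "a \<ge> 0" "b \<ge> 0" "a * b < 1" "\<phi> \<in> Aspace a" "f \<in> Aspace b"
  shows "op_apply \<theta> \<phi> f \<in> Aspace (b / (1 - a * b))"
    and "derivs0 (op_apply \<theta> \<phi> f) n = op_coeff \<theta> (derivs0 \<phi>) (derivs0 f) n"
proof -
  have expansion: "op_apply \<theta> \<phi> f holomorphic_on UNIV"
      "derivs0 (op_apply \<theta> \<phi> f) n = op_coeff \<theta> (derivs0 \<phi>) (derivs0 f) n"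
      "norm (op_coeff \<theta> (derivs0 \<phi>) (derivs0 f) n) \<le>
        bnorm a' \<phi> * bnorm b' f * (1 - a' * b') powr (- \<theta>) * (b' / (1 - a' * b')) ^ n"
    if "a' > a" "b' > b" "a' * b' < 1" for a' b' n
  proof -
    have "a' \<ge> 0" "b' \<ge> 0" using that assms by auto
    note * = assms(1) this that(3) Aspace_derivs0_le[OF assms(5) that(1) assms(2)]
      Aspace_derivs0_le[OF assms(6) that(2) assms(3)]
    show "op_apply \<theta> \<phi> f holomorphic_on UNIV"
      "derivs0 (op_apply \<theta> \<phi> f) n = op_coeff \<theta> (derivs0 \<phi>) (derivs0 f) n"
      using op_apply_expansion(3,4)[OF *] by blast+
    show "norm (op_coeff \<theta> (derivs0 \<phi>) (derivs0 f) n) \<le>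
        bnorm a' \<phi> * bnorm b' f * (1 - a' * b') powr (- \<theta>) * (b' / (1 - a' * b')) ^ n"
      using op_term_bound(4)[OF *] .
  qed
  \<comment> \<open>Any admissible radii do, since the two facts drawn from them do not mention the
    radii.\<close>
  obtain a\<^sub>1 b\<^sub>1 where r\<^sub>1: "a\<^sub>1 > a" "b\<^sub>1 > b" "a\<^sub>1 * b\<^sub>1 < 1"
    using enlarged_radii[OF assms(2-4) less_add_one] by metis
  show "derivs0 (op_apply \<theta> \<phi> f) n = op_coeff \<theta> (derivs0 \<phi>) (derivs0 f) n"
    by (rule expansion(2)[OF r\<^sub>1])
  show "op_apply \<theta> \<phi> f \<in> Aspace (b / (1 - a * b))"
  proof (rule AspaceI)
    show "op_apply \<theta> \<phi> f holomorphic_on UNIV" by (rule expansion(1)[OF r\<^sub>1])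
  next
    fix c' assume "c' > b / (1 - a * b)"
    then obtain a' b' where r: "a' > a" "b' > b" "a' * b' < 1" "b' / (1 - a' * b') < c'"
      using enlarged_radii[OF assms(2-4)] by blast
    define K where "K = bnorm a' \<phi> * bnorm b' f * (1 - a' * b') powr (- \<theta>)"
    have "K \<ge> 0" unfolding K_def using r assms
      by (intro mult_nonneg_nonneg Aspace_bnorm_nonneg[of _ a] Aspace_bnorm_nonneg[of _ b]) auto
    have "norm (derivs0 (op_apply \<theta> \<phi> f) n) \<le> K * c' ^ n" for n
    proof -
      have "norm (derivs0 (op_apply \<theta> \<phi> f) n) \<le> K * (b' / (1 - a' * b')) ^ n"
        using expansion(2,3)[OF r(1-3)] by (simp add: K_def)
      also have "\<dots> \<le> K * c' ^ n"
        using r assms \<open>K \<ge> 0\<close> by (intro mult_left_mono power_mono) auto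
      finally show ?thesis .
    qed
    thus "\<exists>K. \<forall>n. norm (derivs0 (op_apply \<theta> \<phi> f) n) \<le> K * c' ^ n" by blast
  qed (use assms in auto)
qed

text \<open>By bilinearity the difference splits into the parts from \<open>(u, v)\<close>,
  \<open>(u, v0)\<close> and \<open>(u0, v)\<close>, where \<open>u\<close> and \<open>v\<close> are
  the derivatives of the perturbations; \<open>op_term_bound\<close> bounds each part.\<close>

lemma op_apply_diff_bound:
  fixes a b \<theta> a' b' c' :: real
  assumes ab: "\<theta> \<ge> 0" "a \<ge> 0" "b \<ge> 0" "a * b < 1"
    and r: "a' > a" "b' > b" "a' * b' < 1" "b' / (1 - a' * b') < c'"
    and A: "\<phi> \<in> Aspace a" "\<phi>\<^sub>0 \<in> Aspace a" "f \<in> Aspace b" "f\<^sub>0 \<in> Aspace b"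
    and e: "bnorm a' (\<lambda>z. \<phi> z - \<phi>\<^sub>0 z) \<le> e" "bnorm b' (\<lambda>z. f z - f\<^sub>0 z) \<le> e"
  shows "bnorm c' (\<lambda>z. op_apply \<theta> \<phi> f z - op_apply \<theta> \<phi>\<^sub>0 f\<^sub>0 z) \<le>
     (1 - a' * b') powr (- \<theta>) * (e * e + e * bnorm b' f\<^sub>0 + bnorm a' \<phi>\<^sub>0 * e)"
proof -
  define u u0 v v0 where "u = derivs0 (\<lambda>z. \<phi> z - \<phi>\<^sub>0 z)" and "u0 = derivs0 \<phi>\<^sub>0"
    and "v = derivs0 (\<lambda>z. f z - f\<^sub>0 z)" and "v0 = derivs0 f\<^sub>0"
  define U V K d where "U = bnorm a' \<phi>\<^sub>0" and "V = bnorm b' f\<^sub>0"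
    and "K = (1 - a' * b') powr (- \<theta>)" and "d = b' / (1 - a' * b')"
  have pos: "a' > 0" "b' > 0" using r ab by auto
  hence d: "0 < d" "d < c'" using r(3,4) by (auto simp: d_def)
  have u: "norm (u k) \<le> e * a' ^ k" for k
    unfolding u_def
    by (rule order_trans[OF Aspace_derivs0_le[OF Aspace_diff[OF A(1,2) ab(2)] r(1) ab(2)]
          mult_right_mono[OF e(1)]]) (use pos in simp)
  have v: "norm (v k) \<le> e * b' ^ k" for k
    unfolding v_def
    by (rule order_trans[OF Aspace_derivs0_le[OF Aspace_diff[OF A(3,4) ab(3)] r(2) ab(3)]
          mult_right_mono[OF e(2)]]) (use pos in simp)
  have u0: "norm (u0 k) \<le> U * a' ^ k" and v0: "norm (v0 k) \<le> V * b' ^ k" for k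
    using Aspace_derivs0_le A r ab by (auto simp: u0_def v0_def U_def V_def)
  have e0: "e \<ge> 0" "U \<ge> 0" "V \<ge> 0"
    using order_trans[OF norm_ge_zero u[of 0]] order_trans[OF norm_ge_zero u0[of 0]]
      order_trans[OF norm_ge_zero v0[of 0]] by simp_all
  note bounds = op_term_bound(3,4)[OF ab(1) less_imp_le[OF pos(1)] less_imp_le[OF pos(2)] r(3)]
  have eq: "derivs0 (\<lambda>z. op_apply \<theta> \<phi> f z - op_apply \<theta> \<phi>\<^sub>0 f\<^sub>0 z) n =
      op_coeff \<theta> u v n + op_coeff \<theta> u v0 n + op_coeff \<theta> u0 v n" for n
  proof -
    have s: "summable (op_term \<theta> u v n)" "summable (op_term \<theta> u v0 n)" "summable (op_term \<theta> u0 v n)"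
      "summable (op_term \<theta> u0 v0 n)"
      using bounds(1)[OF u v] bounds(1)[OF u v0] bounds(1)[OF u0 v] bounds(1)[OF u0 v0]
      by (auto intro: summable_norm_cancel)
    have \<phi>: "derivs0 \<phi> = (\<lambda>k. u k + u0 k)" and f: "derivs0 f = (\<lambda>k. v k + v0 k)"
      using Aspace_derivs0_diff A by (auto simp: u_def u0_def v_def v0_def fun_eq_iff)
    have "op_term \<theta> (derivs0 \<phi>) (derivs0 f) n =
        (\<lambda>k. op_term \<theta> u v n k + op_term \<theta> u v0 n k + op_term \<theta> u0 v n k + op_term \<theta> u0 v0 n k)"
      by (rule ext) (simp only: op_term_def \<phi> f ring_distribs add_ac)
    moreover have "(\<lambda>k. op_term \<theta> u v n k + op_term \<theta> u v0 n k + op_term \<theta> u0 v n k + op_term \<theta> u0 v0 n k)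
        sums (op_coeff \<theta> u v n + op_coeff \<theta> u v0 n + op_coeff \<theta> u0 v n + op_coeff \<theta> u0 v0 n)"
      unfolding op_coeff_def by (intro sums_add summable_sums s)
    ultimately have "op_coeff \<theta> (derivs0 \<phi>) (derivs0 f) n =
        op_coeff \<theta> u v n + op_coeff \<theta> u v0 n + op_coeff \<theta> u0 v n + op_coeff \<theta> u0 v0 n"
      unfolding op_coeff_def[of \<theta> "derivs0 \<phi>"] by (simp add: sums_iff)
    moreover have "derivs0 (\<lambda>z. op_apply \<theta> \<phi> f z - op_apply \<theta> \<phi>\<^sub>0 f\<^sub>0 z) n =
        op_coeff \<theta> (derivs0 \<phi>) (derivs0 f) n - op_coeff \<theta> u0 v0 n"
      unfolding u0_def v0_def
      using op_apply_Aspace[OF ab A(1,3)] op_apply_Aspace[OF ab A(2,4)]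
      by (subst Aspace_derivs0_diff) auto
    ultimately show ?thesis by simp
  qed
  show ?thesis
    unfolding K_def[symmetric] U_def[symmetric] V_def[symmetric]
  proof (rule bnorm_le)
    fix n
    have "norm (op_coeff \<theta> u v n + op_coeff \<theta> u v0 n + op_coeff \<theta> u0 v n)
      \<le> e * e * K * d ^ n + e * V * K * d ^ n + U * e * K * d ^ n"
      unfolding K_def d_def
      by (intro norm_triangle_le add_mono bounds(2) u v u0 v0)
    also have "\<dots> = K * (e * e + e * V + U * e) * d ^ n" by (simp add: algebra_simps)
    also have "\<dots> \<le> K * (e * e + e * V + U * e) * c' ^ n"
      using e0 d by (intro mult_left_mono power_mono) (auto simp: K_def)
    finally show "norm (derivs0 (\<lambda>z. op_apply \<theta> \<phi> f z - op_apply \<theta> \<phi>\<^sub>0 f\<^sub>0 z) n)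
        \<le> K * (e * e + e * V + U * e) * c' ^ n" unfolding eq .
  qed (use d in auto)
qed

text \<open>It suffices to consider preimages of subbasic sets. Around each point of such a
  preimage, one seminorm ball in each factor gives a product neighbourhood inside it.\<close>

lemma continuous_map_op_apply:
  fixes a b \<theta> :: real
  assumes ab: "\<theta> \<ge> 0" "a \<ge> 0" "b \<ge> 0" "a * b < 1"
  shows "continuous_map (prod_topology (Atop a) (Atop b)) (Atop (b / (1 - a * b)))
     (\<lambda>(\<phi>, f). op_apply \<theta> \<phi> f)"
proof -
  define c where "c = b / (1 - a * b)"
  have "c \<ge> 0" using ab by (simp add: c_def)
  have opA: "op_apply \<theta> \<phi> f \<in> Aspace c" if "\<phi> \<in> Aspace a" "f \<in> Aspace b" for \<phi> f
    unfolding c_def by (rule op_apply_Aspace(1)[OF ab that])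
  let ?X = "prod_topology (Atop a) (Atop b)" and ?F = "\<lambda>(\<phi>, f). op_apply \<theta> \<phi> f"
  have X: "topspace ?X = Aspace a \<times> Aspace b" by (simp add: topspace_Atop)
  have "continuous_map ?X (Atop c) ?F"
    unfolding Atop_def[of c]
  proof (rule continuous_on_generated_topo)
    show "?F ` topspace ?X \<subseteq> \<Union>{{g \<in> Aspace c. bnorm b (\<lambda>z. g z - f z) < e} |f b e.
        f \<in> Aspace c \<and> c < b \<and> 0 < e}"
      using opA topspace_Atop[of c] unfolding X Atop_def topology_generated_by_topspace by auto
  next
    fix W assume "W \<in> {{g \<in> Aspace c. bnorm b (\<lambda>z. g z - f z) < e} |f b e.
        f \<in> Aspace c \<and> c < b \<and> 0 < e}"
    then obtain h c' \<epsilon> where W: "W = {g \<in> Aspace c. bnorm c' (\<lambda>z. g z - h z) < \<epsilon>}"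
      and h: "h \<in> Aspace c" "c < c'" by blast
    obtain a' b' where r: "a' > a" "b' > b" "a' * b' < 1" "b' / (1 - a' * b') < c'"
      using enlarged_radii[OF ab(2-4)] h(2) unfolding c_def by blast
    show "openin ?X (?F -` W \<inter> topspace ?X)"
    proof (subst openin_subopen, intro ballI)
      fix x assume "x \<in> ?F -` W \<inter> topspace ?X"
      then obtain \<phi>\<^sub>0 f\<^sub>0 where x: "x = (\<phi>\<^sub>0, f\<^sub>0)" "\<phi>\<^sub>0 \<in> Aspace a" "f\<^sub>0 \<in> Aspace b"
        and lt: "bnorm c' (\<lambda>z. op_apply \<theta> \<phi>\<^sub>0 f\<^sub>0 z - h z) < \<epsilon>"
        unfolding X W by auto
      \<comment> \<open>The centre \<open>h\<close> of \<open>W\<close> is arbitrary; \<delta> is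
        the room left by the image of the base point.\<close>
      define \<delta> where "\<delta> = \<epsilon> - bnorm c' (\<lambda>z. op_apply \<theta> \<phi>\<^sub>0 f\<^sub>0 z - h z)"
      \<comment> \<open>As \<open>e \<le> 1\<close> gives \<open>e * e \<le> e\<close>, the bound of
        \<open>op_apply_diff_bound\<close> is at most \<open>e * M\<close>.\<close>
      define M where "M = (1 - a' * b') powr (- \<theta>) * (1 + bnorm b' f\<^sub>0 + bnorm a' \<phi>\<^sub>0)"
      have nn: "bnorm b' f\<^sub>0 \<ge> 0" "bnorm a' \<phi>\<^sub>0 \<ge> 0"
        using Aspace_bnorm_nonneg x r ab by auto
      have "M > 0" using nn r(3) by (simp add: M_def add_pos_nonneg)
      \<comment> \<open>The factor \<open>2\<close> makes \<open>e * M < \<delta>\<close>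
        strict.\<close>
      define e where "e = min 1 (\<delta> / (2 * M))"
      have e: "e > 0" "e \<le> 1" "e * M < \<delta>"
      proof -
        have "\<delta> > 0" using lt by (simp add: \<delta>_def)
        thus "e > 0" using \<open>M > 0\<close> by (simp add: e_def)
        show "e \<le> 1" by (simp add: e_def)
        have "e * M \<le> \<delta> / (2 * M) * M" using \<open>M > 0\<close> by (intro mult_right_mono) (auto simp: e_def)
        thus "e * M < \<delta>" using \<open>M > 0\<close> \<open>\<delta> > 0\<close> by simp
      qed
      let ?V = "{\<phi> \<in> Aspace a. bnorm a' (\<lambda>z. \<phi> z - \<phi>\<^sub>0 z) < e}"
      let ?W = "{f \<in> Aspace b. bnorm b' (\<lambda>z. f z - f\<^sub>0 z) < e}"
      have "openin ?X (?V \<times> ?W)"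
        unfolding openin_prod_Times_iff using openin_Atop_ball x r e by blast
      moreover have "x \<in> ?V \<times> ?W" using x e by (simp add: bnorm_zero)
      moreover have "?V \<times> ?W \<subseteq> ?F -` W \<inter> topspace ?X"
      proof safe
        fix \<phi> f
        assume \<phi>: "\<phi> \<in> Aspace a" "bnorm a' (\<lambda>z. \<phi> z - \<phi>\<^sub>0 z) < e"
          and f: "f \<in> Aspace b" "bnorm b' (\<lambda>z. f z - f\<^sub>0 z) < e"
        have "bnorm c' (\<lambda>z. op_apply \<theta> \<phi> f z - op_apply \<theta> \<phi>\<^sub>0 f\<^sub>0 z) \<le>
            (1 - a' * b') powr (- \<theta>) * (e * e + e * bnorm b' f\<^sub>0 + bnorm a' \<phi>\<^sub>0 * e)"
          using op_apply_diff_bound[OF ab r \<phi>(1) x(2) f(1) x(3)] \<phi>(2) f(2) by simp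
        also have "\<dots> \<le> (1 - a' * b') powr (- \<theta>) * (e * 1 + e * bnorm b' f\<^sub>0 + bnorm a' \<phi>\<^sub>0 * e)"
          using e by (intro mult_left_mono add_right_mono) auto
        also have "\<dots> = e * M" by (simp add: M_def algebra_simps)
        finally have "bnorm c' (\<lambda>z. op_apply \<theta> \<phi> f z - op_apply \<theta> \<phi>\<^sub>0 f\<^sub>0 z) < \<delta>"
          using e(3) by linarith
        moreover have "bnorm c' (\<lambda>z. op_apply \<theta> \<phi> f z - h z) \<le>
            bnorm c' (\<lambda>z. op_apply \<theta> \<phi> f z - op_apply \<theta> \<phi>\<^sub>0 f\<^sub>0 z) +
            bnorm c' (\<lambda>z. op_apply \<theta> \<phi>\<^sub>0 f\<^sub>0 z - h z)"
          by (rule bnorm_triangle[OF opA[OF \<phi>(1) f(1)] opA[OF x(2,3)] h \<open>c \<ge> 0\<close>])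
        ultimately have "bnorm c' (\<lambda>z. op_apply \<theta> \<phi> f z - h z) < \<epsilon>"
          by (simp add: \<delta>_def)
        thus "(\<phi>, f) \<in> ?F -` W" using opA[OF \<phi>(1) f(1)] by (simp add: W)
      qed (auto simp: topspace_Atop)
      ultimately show "\<exists>T. openin ?X T \<and> x \<in> T \<and> T \<subseteq> ?F -` W \<inter> topspace ?X" by blast
    qed
  qed
  thus ?thesis by (simp add: c_def)
qed

theorem theorem1p3:
  fixes \<theta> a b c :: real
  assumes "\<theta> \<ge> 0" and "a \<ge> 0" and "b \<ge> 0" and "a * b < 1"
    and "c = b / (1 - a * b)"
  shows "(\<forall>\<phi> \<in> Lplus_a a. \<forall>f \<in> Lplus_a b. op_apply \<theta> \<phi> f \<in> Lplus_a c) \<and>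
         continuous_map
           (subtopology (prod_topology (Atop a) (Atop b)) (Lplus_a a \<times> Lplus_a b))
           (subtopology (Atop c) (Lplus_a c))
           (\<lambda>(\<phi>, f). op_apply \<theta> \<phi> f)"
proof -
  have mem: "op_apply \<theta> \<phi> f \<in> Lplus_a c" if "\<phi> \<in> Lplus_a a" "f \<in> Lplus_a b" for \<phi> f
  proof -
    have A: "\<phi> \<in> Aspace a" "f \<in> Aspace b" and L: "\<phi> \<in> Lplus" "f \<in> Lplus"
      using that by (auto simp: Lplus_a_def)
    \<comment> \<open>No geometric bounds are given at \<open>a\<close> and \<open>b\<close>
      themselves, so larger radii are used; membership in \<open>Lplus\<close> does not depend on
      them.\<close>
    obtain a' b' where r: "a' > a" "b' > b" "a' * b' < 1"
      using enlarged_radii[OF assms(2-4) less_add_one] by metis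
    hence "a' \<ge> 0" "b' \<ge> 0" using assms by auto
    hence "op_apply \<theta> \<phi> f \<in> Lplus"
      using op_apply_in_Lplus[OF assms(1) _ _ r(3) Aspace_derivs0_le[OF A(1) r(1) assms(2)]
          Aspace_derivs0_le[OF A(2) r(2) assms(3)] L] by blast
    thus ?thesis
      using op_apply_Aspace(1)[OF assms(1-4) A] assms(5) by (simp add: Lplus_a_def)
  qed
  moreover have "continuous_map
           (subtopology (prod_topology (Atop a) (Atop b)) (Lplus_a a \<times> Lplus_a b))
           (subtopology (Atop c) (Lplus_a c)) (\<lambda>(\<phi>, f). op_apply \<theta> \<phi> f)"
    unfolding continuous_map_in_subtopology
    using continuous_map_from_subtopology[OF continuous_map_op_apply[OF assms(1-4)]] mem assms(5)
    by (auto simp: topspace_subtopology)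
  ultimately show ?thesis by blast
qed

end
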